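(* Let $(\delta^*,\omega^* )\in\Omega$ be an equilibrium point (EP) of the multi-microgrid system $$\dot\delta_i=\omega_i,\qquad m_i\dot\omega_i+d_i\omega_i=P_{s_i}-P_{e_i}(\delta),\qquad i\in\mathcal N=\{1,\dots,n\},$$ let $J$ be the Jacobian of the vector field at this EP, and let $B\in\mathbb R^{n\times n}$ be the imaginary part of the admittance matrix. Suppose $m_i>0$ and $d_i>0$ for all $i\in\mathcal N$, and that the linking grid $\mathcal G$ is connected. Then: (a) $J$ has a zero eigenvalue with geometric multiplicity one. (b) All the nonzero real eigenvalues of $J$ are negative. (c) Let $Q_i$ be the net outgoing reactive power flow from node $i$ at the EP. If $$-Q_i-V_i^2B_{ii}\le \frac{d_i^2}{2m_i}\qquad\forall i\in\mathcal N,$$ then all the nonzero eigenvalues of $J$, both real and complex, lie in the open left half plane, i.e. $\sigma(J)\subset\mathbb C_-\cup\{0\}$, and the EP is locally asymptotically stable. (d) If the transfer conductance of the lines is zero ($g_{ik}=0$ for all $i\neq k$), then all the nonzero eigenvalues of $J$ lie in the open left half plane, and the EP is locally asymptotically stable.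
   Context: Network. $\mathcal G=(\mathcal N,\mathcal E)$ is an undirected graph with $\mathcal N=\{1,\dots,n\}$ (nodes are microgrids). Distinct nodes $i,k$ are joined by a line of admittance $y_{ik}=y_{ki}=g_{ik}+\mathrm j b_{ik}$ with $g_{ik}\ge 0$, $b_{ik}\le 0$ ($y_{ik}=0$ if there is no line); $y_{ii}$ is the admittance-to-ground at node $i$. The symmetric admittance matrix has diagonal entries $Y_{ii}\measuredangle\theta_{ii}=\sum_{k=1}^n y_{ik}$ and off-diagonal entries $Y_{ik}\measuredangle\theta_{ik}=-y_{ik}$, where $Y_{ik}\ge 0$ is the modulus and $\theta_{ik}$ the argument. $B$ is the imaginary part of this matrix, so $B_{ii}=Y_{ii}\sin\theta_{ii}$. $\mathcal G$ is connected if any two distinct nodes are joined by a path of lines with nonzero admittance. $\mathcal A$ is the set of ordered pairs $(i,k)$, $i\ne k$, with $y_{ik}\neq 0$. Dynamics. $V_i>0$ are constant voltage magnitudes, $P_{s_i}\in\mathbb R$ are constant setpoints, $m_i$ is the inertia and $d_i$ the damping of node $i$, and $$P_{e_i}(\delta)=\sum_{k=1}^n V_iV_kY_{ik}\cos(\theta_{ik}-\delta_i+\delta_k).$$ An EP is a point $(\delta^*,\omega^* )\in\mathbb R^{2n}$ with $\omega^*=0$ and $P_{e_i}(\delta^* )=P_{s_i}$ for all $i$. The net outgoing reactive power at node $i$ is $$Q_i=-\sum_{k=1}^nV_iV_kY_{ik}\sin(\theta_{ik}-\delta_i^*+\delta_k^* ).$$ Moreover $$\Omega=\{(\delta,\omega)\in\mathbb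 R^{2n}:\ 0<\theta_{ik}-\delta_i+\delta_k<\pi\ \ \forall (i,k)\in\mathcal A,\ \omega=0\}.$$ Jacobian. With $M=\mathrm{diag}(m_1,\dots,m_n)$, $D=\mathrm{diag}(d_1,\dots,d_n)$ and $L$ the Jacobian matrix of $P_e=(P_{e_1},\dots,P_{e_n})$ at $\delta^*$, i.e. $L_{ii}=\sum_{k\ne i}V_iV_kY_{ik}\sin(\theta_{ik}-\delta^*_i+\delta^*_k)$ and $L_{ik}=-V_iV_kY_{ik}\sin(\theta_{ik}-\delta^*_i+\delta^*_k)$ for $i\ne k$, $$J=\begin{bmatrix}0&I\\-M^{-1}L&-M^{-1}D\end{bmatrix}\in\mathbb R^{2n\times 2n}.$$ $\sigma(J)$ is the spectrum of $J$ and $\mathbb C_-$ is the set of complex numbers with negative real part. Stability convention. Since $P_e(\delta+\alpha\mathbf 1)=P_e(\delta)$ for all $\alpha\in\mathbb R$ ($\mathbf 1$ the all-ones vector), EPs come in families $\{(\delta^*+\alpha\mathbf 1,0):\alpha\in\mathbb R\}$. Local asymptotic stability of an EP is understood after choosing a reference bus and referring all other angles to it (equivalently, for the induced system on $(\mathbb R^n/\mathbb R\mathbf 1)\times\mathbb R^n$), so that each such family becomes a single EP. *)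

theory Defs
  imports "HOL-Analysis.Analysis"
begin

section \<open>The network\<close>

text \<open>
  Nodes are the elements of a finite type \<open>'n\<close>.  For \<open>i \<noteq> k\<close>, \<open>y i k\<close> is the admittance of the
  line between \<open>i\<close> and \<open>k\<close> (zero if there is none); \<open>y i i\<close> is the admittance-to-ground at \<open>i\<close>.
\<close>

definition line_admittances :: "('n \<Rightarrow> 'n \<Rightarrow> complex) \<Rightarrow> bool" where
  "line_admittances y \<longleftrightarrow>
     (\<forall>i k. y i k = y k i) \<and> (\<forall>i k. i \<noteq> k \<longrightarrow> 0 \<le> Re (y i k) \<and> Im (y i k) \<le> 0)"

definition admittance_matrix :: "('n::finite \<Rightarrow> 'n \<Rightarrow> complex) \<Rightarrow> complex^'n^'n" where
  "admittance_matrix y = (\<chi> i k. if i = k then (\<Sum>l\<in>UNIV. y i l) else - y i k)"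

definition Ymod :: "('n::finite \<Rightarrow> 'n \<Rightarrow> complex) \<Rightarrow> 'n \<Rightarrow> 'n \<Rightarrow> real" where
  "Ymod y i k = cmod (admittance_matrix y $ i $ k)"

text \<open>
  The argument is the principal one, in \<open>(-pi, pi]\<close>.  As \<open>- y i k\<close> lies in the closed second
  quadrant for \<open>i \<noteq> k\<close>, the angle of every line belongs to \<open>[pi/2, pi]\<close>.
\<close>

definition Yang :: "('n::finite \<Rightarrow> 'n \<Rightarrow> complex) \<Rightarrow> 'n \<Rightarrow> 'n \<Rightarrow> real" where
  "Yang y i k = Arg (admittance_matrix y $ i $ k)"

definition susceptance_matrix :: "('n::finite \<Rightarrow> 'n \<Rightarrow> complex) \<Rightarrow> real^'n^'n" where
  "susceptance_matrix y = map_matrix Im (admittance_matrix y)"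

definition lines :: "('n \<Rightarrow> 'n \<Rightarrow> complex) \<Rightarrow> ('n \<times> 'n) set" where
  "lines y = {(i, k). i \<noteq> k \<and> y i k \<noteq> 0}"

definition connected_grid :: "('n \<Rightarrow> 'n \<Rightarrow> complex) \<Rightarrow> bool" where
  "connected_grid y \<longleftrightarrow> (\<forall>i k. i \<noteq> k \<longrightarrow> (i, k) \<in> (lines y)\<^sup>*)"


section \<open>The dynamics\<close>

definition Pe :: "('n::finite \<Rightarrow> 'n \<Rightarrow> complex) \<Rightarrow> ('n \<Rightarrow> real) \<Rightarrow> real^'n \<Rightarrow> real^'n" where
  "Pe y V \<delta> = (\<chi> i. \<Sum>k\<in>UNIV. V i * V k * Ymod y i k * cos (Yang y i k - \<delta> $ i + \<delta> $ k))"

definition Qnet :: "('n::finite \<Rightarrow> 'n \<Rightarrow> complex) \<Rightarrow> ('n \<Rightarrow> real) \<Rightarrow> real^'n \<Rightarrow> 'n \<Rightarrow> real" where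
  "Qnet y V \<delta> i = - (\<Sum>k\<in>UNIV. V i * V k * Ymod y i k * sin (Yang y i k - \<delta> $ i + \<delta> $ k))"

definition vector_field ::
  "('n::finite \<Rightarrow> 'n \<Rightarrow> complex) \<Rightarrow> ('n \<Rightarrow> real) \<Rightarrow> ('n \<Rightarrow> real) \<Rightarrow> ('n \<Rightarrow> real) \<Rightarrow> ('n \<Rightarrow> real)
    \<Rightarrow> (real^'n) \<times> (real^'n) \<Rightarrow> (real^'n) \<times> (real^'n)" where
  "vector_field y V Ps m d =
     (\<lambda>(\<delta>, \<omega>). (\<omega>, \<chi> i. (Ps i - Pe y V \<delta> $ i - d i * \<omega> $ i) / m i))"

definition is_EP ::
  "('n::finite \<Rightarrow> 'n \<Rightarrow> complex) \<Rightarrow> ('n \<Rightarrow> real) \<Rightarrow> ('n \<Rightarrow> real)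
    \<Rightarrow> (real^'n) \<times> (real^'n) \<Rightarrow> bool" where
  "is_EP y V Ps = (\<lambda>(\<delta>, \<omega>). \<omega> = 0 \<and> (\<forall>i. Pe y V \<delta> $ i = Ps i))"

definition Omega :: "('n::finite \<Rightarrow> 'n \<Rightarrow> complex) \<Rightarrow> ((real^'n) \<times> (real^'n)) set" where
  "Omega y = {(\<delta>, \<omega>).
     (\<forall>(i, k) \<in> lines y. 0 < Yang y i k - \<delta> $ i + \<delta> $ k \<and> Yang y i k - \<delta> $ i + \<delta> $ k < pi) \<and>
     \<omega> = 0}"


section \<open>The Jacobian\<close>

definition diag_matrix :: "('n \<Rightarrow> 'a::zero) \<Rightarrow> 'a^'n^'n" where
  "diag_matrix a = (\<chi> i k. if i = k then a i else 0)"

definition block_matrix ::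
  "'a^'n^'n \<Rightarrow> 'a^'n^'n \<Rightarrow> 'a^'n^'n \<Rightarrow> 'a^'n^'n \<Rightarrow> 'a^('n + 'n)^('n + 'n)" where
  "block_matrix A B C D = (\<chi> p q.
     case p of
       Inl i \<Rightarrow> (case q of Inl k \<Rightarrow> A $ i $ k | Inr k \<Rightarrow> B $ i $ k)
     | Inr i \<Rightarrow> (case q of Inl k \<Rightarrow> C $ i $ k | Inr k \<Rightarrow> D $ i $ k))"

definition Lmat :: "('n::finite \<Rightarrow> 'n \<Rightarrow> complex) \<Rightarrow> ('n \<Rightarrow> real) \<Rightarrow> real^'n \<Rightarrow> real^'n^'n" where
  "Lmat y V \<delta> = (\<chi> i k.
     if i = k then (\<Sum>l\<in>UNIV - {i}. V i * V l * Ymod y i l * sin (Yang y i l - \<delta> $ i + \<delta> $ l))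
     else - (V i * V k * Ymod y i k * sin (Yang y i k - \<delta> $ i + \<delta> $ k)))"

definition Jmat ::
  "('n::finite \<Rightarrow> 'n \<Rightarrow> complex) \<Rightarrow> ('n \<Rightarrow> real) \<Rightarrow> ('n \<Rightarrow> real) \<Rightarrow> ('n \<Rightarrow> real) \<Rightarrow> real^'n
    \<Rightarrow> real^('n + 'n)^('n + 'n)" where
  "Jmat y V m d \<delta> =
     block_matrix 0 (mat 1)
       (- (matrix_inv (diag_matrix m) ** Lmat y V \<delta>))
       (- (matrix_inv (diag_matrix m) ** diag_matrix d))"

lemma Lmat_mult_nth:
  "(Lmat y V \<delta> *v h) $ i =
     (\<Sum>k\<in>UNIV. V i * V k * Ymod y i k * sin (Yang y i k - \<delta> $ i + \<delta> $ k) * (h $ i - h $ k))"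
proof -
  define w where "w k = V i * V k * Ymod y i k * sin (Yang y i k - \<delta> $ i + \<delta> $ k)" for k
  have "(Lmat y V \<delta> *v h) $ i = (\<Sum>k\<in>UNIV. Lmat y V \<delta> $ i $ k * h $ k)"
    by (simp add: matrix_vector_mult_def)
  also have "\<dots> = Lmat y V \<delta> $ i $ i * h $ i + (\<Sum>k\<in>UNIV - {i}. Lmat y V \<delta> $ i $ k * h $ k)"
    by (rule sum.remove) auto
  also have "\<dots> = (\<Sum>k\<in>UNIV - {i}. w k) * h $ i + (\<Sum>k\<in>UNIV - {i}. - w k * h $ k)"
    by (simp add: Lmat_def w_def)
  also have "\<dots> = (\<Sum>k\<in>UNIV - {i}. w k * (h $ i - h $ k))"
    by (simp add: sum_distrib_right sum_subtractf sum_negf right_diff_distrib)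
  also have "\<dots> = (\<Sum>k\<in>UNIV. w k * (h $ i - h $ k))"
    by (simp add: sum.remove[of UNIV i])
  finally show ?thesis by (simp add: w_def)
qed

lemma has_derivative_Pe:
  fixes y :: "'n::finite \<Rightarrow> 'n \<Rightarrow> complex"
  shows "(Pe y V has_derivative (\<lambda>h. Lmat y V \<delta> *v h)) (at \<delta>)"
proof (rule has_derivative_componentwise_within[THEN iffD2], rule ballI)
  fix b :: "real^'n" assume "b \<in> Basis"
  then obtain i where b: "b = axis i 1" by (auto simp: Basis_vec_def)
  have "((\<lambda>x. \<Sum>k\<in>UNIV. V i * V k * Ymod y i k * cos (Yang y i k - x $ i + x $ k))
      has_derivative (\<lambda>h. \<Sum>k\<in>UNIV. V i * V k * Ymod y i k *
        ((h $ k - h $ i) * - sin (Yang y i k - \<delta> $ i + \<delta> $ k)))) (at \<delta>)"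
    by (auto intro!: derivative_eq_intros bounded_linear.has_derivative[OF bounded_linear_vec_nth]
        sum.cong simp: algebra_simps fun_eq_iff)
  also have "(\<lambda>h. \<Sum>k\<in>UNIV. V i * V k * Ymod y i k *
        ((h $ k - h $ i) * - sin (Yang y i k - \<delta> $ i + \<delta> $ k))) = (\<lambda>h. (Lmat y V \<delta> *v h) $ i)"
    by (auto simp: Lmat_mult_nth fun_eq_iff algebra_simps intro!: sum.cong)
  finally show "((\<lambda>x. Pe y V x \<bullet> b) has_derivative (\<lambda>x. (Lmat y V \<delta> *v x) \<bullet> b)) (at \<delta>)"
    by (simp add: b inner_axis Pe_def)
qed

lemma jacobian_Pe: "jacobian (Pe y V) (at \<delta>) = Lmat y V \<delta>"
proof -
  have "frechet_derivative (Pe y V) (at \<delta>) = (\<lambda>h. Lmat y V \<delta> *v h)"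
    using frechet_derivative_at[OF has_derivative_Pe[of y V \<delta>]] by simp
  then show ?thesis
    by (simp add: jacobian_def)
qed

lemma matrix_inv_diag_matrix:
  fixes m :: "'n::finite \<Rightarrow> real"
  assumes "\<And>i. m i \<noteq> 0"
  shows "matrix_inv (diag_matrix m) = diag_matrix (\<lambda>i. 1 / m i)"
proof -
  have *: "diag_matrix m ** diag_matrix (\<lambda>i. 1 / m i) = mat 1"
    "diag_matrix (\<lambda>i. 1 / m i) ** diag_matrix m = mat 1"
    using assms
    by (auto simp: matrix_matrix_mult_def diag_matrix_def mat_def vec_eq_iff
        if_distrib[of "\<lambda>x. x * _"] if_distrib[of "\<lambda>x. _ * x"] cong: if_cong)
  then have "matrix_inv (diag_matrix m) ** diag_matrix m = mat 1"
    unfolding matrix_inv_def by (metis (mono_tags, lifting) someI_ex)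
  then show ?thesis
    by (metis * matrix_mul_assoc matrix_mul_lid matrix_mul_rid)
qed

definition stack :: "(real^'n) \<times> (real^'n) \<Rightarrow> real^('n + 'n)" where
  "stack x = (\<chi> p. case p of Inl i \<Rightarrow> fst x $ i | Inr i \<Rightarrow> snd x $ i)"

text \<open>\<open>Jmat\<close> is the Jacobian of the vector field, up to the identification of pairs with stacked
  vectors.\<close>

lemma has_derivative_vector_field:
  fixes m :: "'n::finite \<Rightarrow> real"
  assumes m: "\<And>i. m i \<noteq> 0"
  obtains F' where "(vector_field y V Ps m d has_derivative F') (at (\<delta>, \<omega>))"
    and "\<And>h. stack (F' h) = Jmat y V m d \<delta> *v stack h"
proof
  let ?F' = "\<lambda>h. (snd h, \<chi> i. (- (Lmat y V \<delta> *v fst h) $ i - d i * snd h $ i) / m i)"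
  have P: "((\<lambda>x. Pe y V (fst x) $ i) has_derivative (\<lambda>h. (Lmat y V \<delta> *v fst h) $ i))
      (at (\<delta>, \<omega>))" for i
  proof -
    have "(Pe y V has_derivative (\<lambda>h. Lmat y V \<delta> *v h)) (at (fst (\<delta>, \<omega>)))"
      by (simp add: has_derivative_Pe)
    from bounded_linear.has_derivative[OF bounded_linear_vec_nth
        has_derivative_compose[OF has_derivative_fst[OF has_derivative_ident] this]]
    show ?thesis .
  qed
  have W: "((\<lambda>x. snd x $ i) has_derivative (\<lambda>h. snd h $ i)) (at (\<delta>, \<omega>))"
    for i :: 'n and \<delta> \<omega> :: "real^'n"
    by (intro bounded_linear.has_derivative[OF bounded_linear_vec_nth] derivative_intros)
  have "((\<lambda>x. \<chi> i. (Ps i - Pe y V (fst x) $ i - d i * snd x $ i) / m i) has_derivative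
      (\<lambda>h. \<chi> i. (- (Lmat y V \<delta> *v fst h) $ i - d i * snd h $ i) / m i)) (at (\<delta>, \<omega>))"
  proof (rule has_derivative_componentwise_within[THEN iffD2], rule ballI)
    fix b :: "real^'n" assume "b \<in> Basis"
    then obtain i where b: "b = axis i 1" by (auto simp: Basis_vec_def)
    have "((\<lambda>x. (Ps i - Pe y V (fst x) $ i - d i * snd x $ i) / m i) has_derivative
        (\<lambda>h. (0 - (Lmat y V \<delta> *v fst h) $ i - d i * snd h $ i) / m i)) (at (\<delta>, \<omega>))"
      unfolding divide_inverse
      by (intro has_derivative_mult_left has_derivative_diff has_derivative_const P
          has_derivative_mult_right W)
    then show "((\<lambda>x. (\<chi> i. (Ps i - Pe y V (fst x) $ i - d i * snd x $ i) / m i) \<bullet> b)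
        has_derivative
        (\<lambda>h. (\<chi> i. (- (Lmat y V \<delta> *v fst h) $ i - d i * snd h $ i) / m i) \<bullet> b)) (at (\<delta>, \<omega>))"
      by (simp add: b inner_axis)
  qed
  from has_derivative_Pair[OF has_derivative_snd[OF has_derivative_ident] this]
  show "(vector_field y V Ps m d has_derivative ?F') (at (\<delta>, \<omega>))"
    by (simp add: vector_field_def case_prod_beta')
  have split: "(\<Sum>q\<in>UNIV. f q) = (\<Sum>k\<in>UNIV. f (Inl k)) + (\<Sum>k\<in>UNIV. f (Inr k))"
    for f :: "'n + 'n \<Rightarrow> real"
    by (subst UNIV_sum, subst sum.union_disjoint) (auto simp: sum.reindex)
  have mul: "(diag_matrix a ** A) $ i $ k = a i * A $ i $ k"
    for a :: "'n \<Rightarrow> real" and A :: "real^'n^'n" and i k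
    by (simp add: matrix_matrix_mult_def diag_matrix_def if_distrib[of "\<lambda>x. x * _"] cong: if_cong)
  show "stack (?F' h) = Jmat y V m d \<delta> *v stack h" for h
  proof (rule vec_eq_iff[THEN iffD2], rule allI)
    fix p :: "'n + 'n"
    show "stack (?F' h) $ p = (Jmat y V m d \<delta> *v stack h) $ p"
    proof (cases p)
      case (Inl i)
      then show ?thesis
        by (simp add: stack_def Jmat_def block_matrix_def matrix_vector_mult_def split mat_def
            if_distrib[of "\<lambda>x. x * _"] cong: if_cong)
    next
      case (Inr i)
      have "(\<Sum>k\<in>UNIV. diag_matrix d $ i $ k * snd h $ k) = d i * snd h $ i"
        by (simp add: diag_matrix_def if_distrib[of "\<lambda>x. x * _"] cong: if_cong)
      then have "(\<Sum>k\<in>UNIV. diag_matrix d $ i $ k * snd h $ k / m i) = d i * snd h $ i / m i"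
        by (metis sum_divide_distrib)
      moreover have "(\<Sum>k\<in>UNIV. Lmat y V \<delta> $ i $ k * fst h $ k / m i)
          = (\<Sum>k\<in>UNIV. Lmat y V \<delta> $ i $ k * fst h $ k) / m i"
        by (simp add: sum_divide_distrib)
      ultimately show ?thesis
        using Inr
        by (simp add: stack_def Jmat_def block_matrix_def matrix_vector_mult_def split
            matrix_inv_diag_matrix[OF m] mul sum_negf diff_divide_distrib)
    qed
  qed
qed


section \<open>Spectrum of a real matrix\<close>

definition eigenspace :: "real^'n^'n \<Rightarrow> complex \<Rightarrow> (complex^'n) set" where
  "eigenspace A \<mu> = {v. map_matrix complex_of_real A *v v = \<mu> *s v}"

definition spectrum :: "real^'n^'n \<Rightarrow> complex set" where
  "spectrum A = {\<mu>. \<exists>v \<in> eigenspace A \<mu>. v \<noteq> 0}"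

definition geometric_multiplicity :: "real^'n^'n \<Rightarrow> complex \<Rightarrow> nat" where
  "geometric_multiplicity A \<mu> = vec.dim (eigenspace A \<mu>)"


section \<open>Local asymptotic stability\<close>

definition is_solution ::
  "('a::real_normed_vector \<Rightarrow> 'a) \<Rightarrow> 'a set \<Rightarrow> (real \<Rightarrow> 'a) \<Rightarrow> bool" where
  "is_solution f S x \<longleftrightarrow>
     (\<forall>t\<ge>0. x t \<in> S \<and> (x has_vector_derivative f (x t)) (at t within {0..}))"

text \<open>Stability includes the existence of solutions for all \<open>t \<ge> 0\<close> from nearby initial states, so
  that it cannot hold vacuously.\<close>

definition lyapunov_stable ::
  "('a::real_normed_vector \<Rightarrow> 'a) \<Rightarrow> 'a set \<Rightarrow> 'a \<Rightarrow> bool" where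
  "lyapunov_stable f S p \<longleftrightarrow>
     (\<forall>\<epsilon>>0. \<exists>\<eta>>0. \<forall>x0\<in>S. dist x0 p < \<eta> \<longrightarrow>
        (\<exists>x. is_solution f S x \<and> x 0 = x0) \<and>
        (\<forall>x. is_solution f S x \<and> x 0 = x0 \<longrightarrow> (\<forall>t\<ge>0. dist (x t) p < \<epsilon>)))"

definition locally_attractive ::
  "('a::real_normed_vector \<Rightarrow> 'a) \<Rightarrow> 'a set \<Rightarrow> 'a \<Rightarrow> bool" where
  "locally_attractive f S p \<longleftrightarrow>
     (\<exists>\<eta>>0. \<forall>x. is_solution f S x \<and> dist (x 0) p < \<eta> \<longrightarrow> (x \<longlongrightarrow> p) at_top)"

definition locally_asymptotically_stable ::
  "('a::real_normed_vector \<Rightarrow> 'a) \<Rightarrow> 'a set \<Rightarrow> 'a \<Rightarrow> bool" where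
  "locally_asymptotically_stable f S p \<longleftrightarrow> lyapunov_stable f S p \<and> locally_attractive f S p"

text \<open>
  Referring all angles to bus \<open>r\<close>.  The vector field \<open>F\<close> is invariant under uniform shifts of the
  angles, so if \<open>x' = F x\<close> then the referred state \<open>z = refer r x\<close> satisfies
  \<open>z' = refer r (F z)\<close>, a system on the subspace \<open>range (refer r)\<close> where the angle of \<open>r\<close> is \<open>0\<close>.
\<close>

definition refer :: "'n::finite \<Rightarrow> (real^'n) \<times> (real^'n) \<Rightarrow> (real^'n) \<times> (real^'n)" where
  "refer r = (\<lambda>(\<delta>, \<omega>). (\<chi> i. \<delta> $ i - \<delta> $ r, \<omega>))"

lemma vector_field_refer: "vector_field y V Ps m d (refer r x) = vector_field y V Ps m d x"
  by (simp add: vector_field_def refer_def Pe_def case_prod_beta algebra_simps)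

definition EP_locally_asymptotically_stable ::
  "('n::finite \<Rightarrow> 'n \<Rightarrow> complex) \<Rightarrow> ('n \<Rightarrow> real) \<Rightarrow> ('n \<Rightarrow> real) \<Rightarrow> ('n \<Rightarrow> real) \<Rightarrow> ('n \<Rightarrow> real)
    \<Rightarrow> (real^'n) \<times> (real^'n) \<Rightarrow> bool" where
  "EP_locally_asymptotically_stable y V Ps m d p \<longleftrightarrow>
     (\<forall>r. locally_asymptotically_stable
            (refer r \<circ> vector_field y V Ps m d) (range (refer r)) (refer r p))"

end

theory Submission
  imports Defs "HOL-Computational_Algebra.Fundamental_Theorem_Algebra"
begin

text \<open>
  In \<open>Omega\<close> the matrix \<open>L\<close> is the Laplacian of a strongly connected weighted digraph with weights
  \<open>w i k = V i * V k * Ymod y i k * sin (Yang y i k - \<delta> $ i + \<delta> $ k)\<close>, and an eigenvector of the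
  Jacobian for \<open>l\<close> is determined by an \<open>a \<noteq> 0\<close> with \<open>(l\<^sup>2 M + l D + L) a = 0\<close>.  The minimum principle
  for \<open>L\<close> gives (a).  At a node where the modulus of \<open>a\<close> is maximal,
  \<open>\<bar>l\<^sup>2 m i + l d i + W\<bar> \<le> W\<close> with \<open>W = L i i\<close>; this excludes positive real \<open>l\<close>, and if
  \<open>W \<le> (d i)\<^sup>2 / (2 * m i)\<close> every \<open>l \<noteq> 0\<close> with \<open>Re l \<ge> 0\<close>.  Without transfer conductances \<open>L\<close> is
  symmetric and positive semidefinite, and pairing the equation with \<open>a\<close> leaves a real quadratic
  equation for \<open>l\<close>.

  The zero eigenvalue is simple also algebraically, because \<open>L h = - c D 1\<close> forces \<open>c = 0\<close> by the
  minimum principle.  Hence the linearisation on the space of referred states has all its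
  eigenvalues in the open left half plane, which gives a quadratic Lyapunov function.
\<close>

section \<open>Quadratic Lyapunov functions of linear maps\<close>

text \<open>
  Pairs \<open>(x, y)\<close> stand for \<open>x + i y\<close> in the complexification of a real vector space.
\<close>

definition cscale :: "complex \<Rightarrow> 'a \<times> 'a \<Rightarrow> 'a \<times> 'a::real_vector" where
  "cscale l z = (Re l *\<^sub>R fst z - Im l *\<^sub>R snd z, Re l *\<^sub>R snd z + Im l *\<^sub>R fst z)"

definition cmap :: "('a \<Rightarrow> 'a) \<Rightarrow> 'a \<times> 'a \<Rightarrow> 'a \<times> 'a" where
  "cmap A z = (A (fst z), A (snd z))"

definition cshift :: "('a \<Rightarrow> 'a) \<Rightarrow> complex \<Rightarrow> 'a \<times> 'a \<Rightarrow> 'a \<times> 'a::real_vector" where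
  "cshift A l z = cmap A z - cscale l z"

text \<open>The inner product of pairs is the real part of the Hermitian one, and the part of
  \<open>l\<close> along the imaginary unit moves \<open>z\<close> orthogonally to itself.\<close>

lemma inner_cscale_self: "z \<bullet> cscale l z = Re l * (z \<bullet> z)" for z :: "'a::real_inner \<times> 'a"
  by (cases z) (simp add: cscale_def inner_Pair algebra_simps inner_commute)

lemma linear_cscale: "linear (cscale l)"
  by (rule linearI) (auto simp: cscale_def algebra_simps)

lemma linear_cmap: "linear A \<Longrightarrow> linear (cmap A)"
  by (rule linearI) (auto simp: cmap_def linear_add linear_scale)

lemma linear_cshift: "linear A \<Longrightarrow> linear (cshift A l)"
  unfolding cshift_def by (intro linear_compose_sub linear_cmap linear_cscale)

lemma cmap_cscale: "linear A \<Longrightarrow> cmap A (cscale l z) = cscale l (cmap A z)"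
  by (auto simp: cmap_def cscale_def linear_add linear_diff linear_scale)

lemma cscale_cscale: "cscale l (cscale l' z) = cscale (l * l') z"
  by (auto simp: cscale_def algebra_simps)

lemma cscale_of_real: "cscale (of_real c) z = c *\<^sub>R z"
  by (simp add: cscale_def scaleR_prod_def)

lemma cscale_eq_0_iff: "cscale l z = 0 \<longleftrightarrow> l = 0 \<or> z = 0"
proof
  assume *: "cscale l z = 0"
  show "l = 0 \<or> z = 0"
  proof (cases "l = 0")
    case False
    then have "z = cscale (inverse l * l) z"
      by (simp add: cscale_def)
    also have "\<dots> = 0"
      by (simp add: cscale_cscale[symmetric] * linear_0[OF linear_cscale])
    finally show ?thesis by simp
  qed simp
qed (auto simp: cscale_def zero_prod_def)

lemma cshift_cmap: "linear A \<Longrightarrow> cshift A l (cmap A z) = cmap A (cshift A l z)"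
  by (simp add: cshift_def cmap_cscale linear_diff[OF linear_cmap])

lemma cshift_commute: 
  assumes "linear A" 
  shows "cshift A l (cshift A l' z) = cshift A l' (cshift A l z)"
  unfolding cshift_def
  using assms
  by (simp add: cmap_cscale linear_diff[OF linear_cmap] linear_diff[OF linear_cscale] cscale_cscale algebra_simps)

section \<open>Products of shifts and polynomials in \<open>A\<close>\<close>

abbreviation cshifts :: "('a \<Rightarrow> 'a) \<Rightarrow> complex list \<Rightarrow> 'a \<times> 'a \<Rightarrow> 'a \<times> 'a::real_vector" where
  "cshifts A \<equiv> fold (cshift A)"

lemma cshifts_cshift:
  "linear A \<Longrightarrow> cshifts A ls (cshift A l z) = cshift A l (cshifts A ls z)"
  by (induction ls arbitrary: z) (simp_all add: cshift_commute[of A _ l])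

lemma linear_cshifts: "linear A \<Longrightarrow> linear (cshifts A ls)"
  by (induction ls) (auto simp: linear_compose linear_cshift intro: linear_id linear_ident)

text \<open>This is \<open>p(A)\<close> applied to \<open>z\<close> by Horner's scheme, with complex
  coefficients acting through \<open>cscale\<close>.\<close>

definition peval :: "('a \<Rightarrow> 'a) \<Rightarrow> complex poly \<Rightarrow> 'a \<times> 'a \<Rightarrow> 'a \<times> 'a::real_vector" where
  "peval A p z = fold_coeffs (\<lambda>c r. cscale c z + cmap A r) p 0"

lemma peval_0 [simp]: "peval A 0 z = 0"
  by (simp add: peval_def)

lemma peval_pCons: "linear A \<Longrightarrow> peval A (pCons c p) z = cscale c z + cmap A (peval A p z)"
  unfolding peval_def
  \<comment> \<open>\<open>fold_coeffs\<close> ignores a zero coefficient on top of the zero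
    polynomial, where both sides vanish.\<close>
  by (cases "p = 0 \<and> c = 0")
    (auto simp: fold_coeffs_pCons_coeff_not_0_eq fold_coeffs_pCons_not_0_0_eq cscale_eq_0_iff
      linear_0[OF linear_cmap])

lemma peval_add: "linear A \<Longrightarrow> peval A (p + q) z = peval A p z + peval A q z"
proof (induction p q rule: poly_induct2)
  case (pCons a p b q)
  then show ?case
    by (simp add: peval_pCons linear_add[OF linear_cmap]) (simp add: cscale_def algebra_simps)
qed simp

lemma peval_smult: "linear A \<Longrightarrow> peval A (smult c p) z = cscale c (peval A p z)"
proof (induction p)
  case (pCons a p)
  then show ?case
    by (simp add: peval_pCons cmap_cscale linear_add[OF linear_cscale] cscale_cscale)
qed (simp add: linear_0[OF linear_cscale])

lemma peval_cshift: "linear A \<Longrightarrow> peval A p (cshift A l z) = cshift A l (peval A p z)"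
proof (induction p)
  case (pCons a p)
  then show ?case
    by (simp add: peval_pCons cshift_cmap linear_add[OF linear_cshift])
      (simp add: cshift_def cmap_cscale linear_diff[OF linear_cscale] cscale_cscale mult.commute)
qed (simp add: linear_0[OF linear_cshift])

text \<open>A linear factor of the polynomial becomes one shift applied to the point, so a
  factorisation into roots becomes a list of shifts.\<close>

lemma peval_root_mult: 
  assumes "linear A"
  shows "peval A ([:- l, 1:] * p) z = peval A p (cshift A l z)"
proof -
  have "[:- l, 1:] * p = smult (- l) p + pCons 0 p"
    by simp
  then show ?thesis
    using assms
    by (simp only: peval_add peval_smult peval_pCons peval_cshift)
      (simp add: cshift_def cscale_def)
qed

lemma peval_monom: "linear A \<Longrightarrow> peval A (monom c k) z = cscale c ((cmap A ^^ k) z)"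
  by (induction k) (simp_all add: monom_0 monom_Suc peval_pCons cmap_cscale linear_0[OF linear_cmap] cscale_eq_0_iff)

lemma peval_sum: "linear A \<Longrightarrow> peval A (\<Sum>i\<in>I. p i) z = (\<Sum>i\<in>I. peval A (p i) z)"
  by (induction I rule: infinite_finite_induct) (simp_all add: peval_add)

section \<open>Annihilating products of shifts\<close>

lemma annihilating_poly_exists:
  fixes z :: "'a::euclidean_space \<times> 'a"
  assumes "linear A"
  obtains p where "p \<noteq> 0" "peval A p z = 0"
proof -
  define g where "g k = (cmap A ^^ k) z" for k
  define N where "N = DIM('a \<times> 'a)"
  \<comment> \<open>The iterates \<open>g 0\<close> to \<open>g N\<close> are \<open>N + 1\<close>
    vectors in real dimension \<open>N\<close>. Dependence is stated for their set, so a repeated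
    iterate is treated on its own; it yields a difference of two monomials.\<close>
  show ?thesis
  proof (cases "inj_on g {..N}")
    case False
    then obtain i j where ij: "i \<noteq> j" "g i = g j"
      by (auto simp: inj_on_def)
    let ?p = "monom 1 i + smult (- 1) (monom 1 j) :: complex poly"
    have "coeff ?p i = 1"
      using ij by simp
    then have "?p \<noteq> 0"
      by (metis coeff_0 zero_neq_one)
    moreover have "peval A ?p z = 0"
      unfolding peval_add[OF assms] peval_smult[OF assms] peval_monom[OF assms] g_def[symmetric]
      using ij by (simp add: cscale_def prod_eq_iff)
    ultimately show ?thesis using that by blast
  next
    case True
    then have "card (g ` {..N}) = Suc N"
      by (simp add: card_image)
    then have "dependent (g ` {..N})"
      by (intro dependent_biggerset) (simp add: N_def)
    then obtain u where u: "(\<Sum>v\<in>g ` {..N}. u v *\<^sub>R v) = 0" "\<exists>v\<in>g ` {..N}. u v \<noteq> 0"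
      using dependent_finite[of "g ` {..N}"] by auto
    define p where "p = (\<Sum>i\<le>N. monom (complex_of_real (u (g i))) i)"
    obtain i where i: "i \<le> N" "u (g i) \<noteq> 0" using u(2) by auto
    have "coeff p i = of_real (u (g i))"
      using i(1) by (simp add: p_def coeff_sum)
    then have "p \<noteq> 0" using i(2) by auto
    moreover have "peval A p z = (\<Sum>i\<le>N. u (g i) *\<^sub>R g i)"
      by (simp add: p_def peval_sum[OF assms] peval_monom[OF assms] cscale_of_real g_def)
    then have "peval A p z = 0"
      using u(1) by (simp add: sum.reindex[OF True])
    ultimately show ?thesis using that by blast
  qed
qed

text \<open>A nonconstant annihilating polynomial has a complex root; splitting it off lowers the
  degree by one, and a nonzero constant annihilates only zero.\<close>

lemma cshifts_annihilate_point:
  assumes "linear A" "p \<noteq> 0" "peval A p z = 0"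
  shows "\<exists>ls. cshifts A ls z = 0"
  using assms(2,3)
proof (induction "degree p" arbitrary: p z)
  case 0
  then obtain c where "p = [:c:]" "c \<noteq> 0"
    by (metis degree_eq_zeroE pCons_0_0)
  with 0 have "z = 0"
    by (simp add: peval_pCons[OF \<open>linear A\<close>] cscale_eq_0_iff linear_0[OF linear_cmap[OF \<open>linear A\<close>]])
  then show ?case by (intro exI[of _ "[]"]) simp
next
  case (Suc n)
  then have "\<not> constant (poly p)"
    by (simp add: constant_degree)
  then obtain l where "poly p l = 0"
    using fundamental_theorem_of_algebra by blast
  then obtain q where q: "p = [:- l, 1:] * q"
    by (auto simp: poly_eq_0_iff_dvd)
  with Suc have "q \<noteq> 0" by auto
  then have "degree p = Suc (degree q)"
    unfolding q by (subst degree_mult_eq) auto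
  with Suc have "n = degree q" by simp
  from Suc.hyps(1)[OF this \<open>q \<noteq> 0\<close>] Suc.prems(2) obtain ls
    where "cshifts A ls (cshift A l z) = 0"
    unfolding q peval_root_mult[OF \<open>linear A\<close>] by blast
  then show ?case by (intro exI[of _ "l # ls"]) simp
qed

text \<open>Shifts commute, so either list may act first and the other then acts on zero. This
  merges the lists found for different points.\<close>

lemma cshifts_append_annihilate:
  assumes "linear A" "cshifts A ls z = 0"
  shows "cshifts A (ls @ ks) z = 0" "cshifts A (ks @ ls) z = 0"
proof -
  show "cshifts A (ls @ ks) z = 0"
    by (simp add: assms linear_0[OF linear_cshifts])
  have "cshifts A ls (cshifts A ks z) = cshifts A ks (cshifts A ls z)"
    by (induction ks arbitrary: z) (simp_all add: cshifts_cshift \<open>linear A\<close>)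
  then show "cshifts A (ks @ ls) z = 0"
    by (simp add: assms linear_0[OF linear_cshifts])
qed

text \<open>Lists for the single basis vectors are concatenated into one that annihilates the whole
  basis.\<close>

lemma cshifts_annihilate:
  fixes A :: "'a::euclidean_space \<Rightarrow> 'a"
  assumes "linear A"
  shows "\<exists>ls. \<forall>z. cshifts A ls z = 0"
proof -
  have "\<exists>ls. \<forall>b\<in>B. cshifts A ls b = 0" if "finite B" for B
    using that
  proof (induction B)
    case (insert b B)
    then obtain ls where ls: "\<forall>b\<in>B. cshifts A ls b = 0" by blast
    obtain ks where "cshifts A ks b = 0"
      using annihilating_poly_exists cshifts_annihilate_point assms by metis
    with ls show ?case
      using cshifts_append_annihilate[OF assms] by (metis insert_iff)
  qed simp
  from this[OF finite_Basis] obtain ls where ls: "\<forall>b\<in>Basis. cshifts A ls b = 0" by blast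
  have "cshifts A ls z = 0" for z
    using linear_eq_0_on_span[OF linear_cshifts[OF assms], of Basis ls z] ls by auto
  then show ?thesis by blast
qed

text \<open>If \<open>l\<close> is not an eigenvalue, the shift by \<open>l\<close> is injective and
  can be cancelled from the product.\<close>

lemma cshifts_annihilate_eigenvalues:
  fixes A :: "'a::euclidean_space \<Rightarrow> 'a"
  assumes "linear A"
  obtains ls where "\<And>z. cshifts A ls z = 0" "\<And>l. l \<in> set ls \<Longrightarrow> \<exists>z. z \<noteq> 0 \<and> cmap A z = cscale l z"
proof -
  obtain ls where ls: "\<forall>z. cshifts A ls z = 0"
    using cshifts_annihilate[OF assms] by blast
  define ev where "ev l \<longleftrightarrow> (\<exists>z. z \<noteq> 0 \<and> cmap A z = cscale l z)" for l
  have filter: "cshifts A (filter ev ls) z = 0" if "cshifts A ls z = 0" for ls z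
    using that
  proof (induction ls arbitrary: z)
    case (Cons l ls)
    show ?case
    proof (cases "ev l")
      case True
      with Cons show ?thesis by simp
    next
      case False
      \<comment> \<open>Commutation brings the shift by \<open>l\<close> to the outside, where its
        injectivity applies.\<close>
      have "cshift A l (cshifts A ls z) = 0"
        using Cons.prems by (simp add: cshifts_cshift[OF assms])
      then have "cshifts A ls z = 0"
        using False unfolding ev_def by (metis cshift_def right_minus_eq)
      from Cons.IH[OF this] False show ?thesis by simp
    qed
  qed simp
  show ?thesis
  proof (rule that[of "filter ev ls"])
    show "cshifts A (filter ev ls) z = 0" for z
      using filter ls by blast
  qed (simp add: ev_def)
qed

section \<open>Construction of the Lyapunov form\<close>

lemma bounded_bilinear_plus:
  assumes "bounded_bilinear f" "bounded_bilinear g"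
  shows "bounded_bilinear (\<lambda>u v. f u v + g u v)"
proof -
  interpret f: bounded_bilinear f by (rule assms)
  interpret g: bounded_bilinear g by (rule assms)
  obtain K K' where "\<And>u v. norm (f u v) \<le> norm u * norm v * K"
    "\<And>u v. norm (g u v) \<le> norm u * norm v * K'"
    using f.bounded g.bounded by blast
  then have "norm (f u v + g u v) \<le> norm u * norm v * (K + K')" for u v
    by (simp add: distrib_left norm_triangle_mono)
  then show ?thesis
    by (intro bounded_bilinear.intro exI[of _ "K + K'"])
      (simp_all add: f.add_left f.add_right g.add_left g.add_right f.scaleR_left f.scaleR_right
        g.scaleR_left g.scaleR_right scaleR_add_right)
qed

text \<open>
  With \<open>T' = (A - l) T\<close>, the derivative of \<open>(norm (T z))\<^sup>2\<close> along \<open>A\<close> is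
  \<open>2 Re l (norm (T z))\<^sup>2 + 2 T z \<bullet> T' z\<close>; the cross term is absorbed by a large multiple of the form
  that the induction hypothesis supplies for \<open>T'\<close>.
\<close>

lemma lyapunov_form_cshifts:
  fixes A :: "'a::euclidean_space \<Rightarrow> 'a" and T :: "'a \<times> 'a \<Rightarrow> 'a \<times> 'a"
  assumes A: "linear A"
    and "\<And>l. l \<in> set ls \<Longrightarrow> Re l < 0"
    and "linear T" "\<And>z. T (cmap A z) = cmap A (T z)"
    and "\<And>z. cshifts A ls (T z) = 0"
  shows "\<exists>Q a. bounded_bilinear Q \<and> (\<forall>u v. Q u v = Q v u) \<and> a > (0::real) \<and>
    (\<forall>z. (norm (T z))\<^sup>2 \<le> Q z z \<and> Q z (cmap A z) \<le> - a * Q z z)"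
  using assms(2-)
proof (induction ls arbitrary: T)
  case Nil
  \<comment> \<open>The empty product forces \<open>T\<close> to be zero, so the zero form works
    with any positive rate.\<close>
  have "bounded_bilinear (\<lambda>(u :: 'a \<times> 'a) (v :: 'a \<times> 'a). 0::real)"
    by (rule bounded_bilinear.intro) (auto simp del: split_paired_All intro!: exI[of _ 0])
  then show ?case
    using Nil by (intro exI[of _ "\<lambda>u v. 0"] exI[of _ 1]) auto
next
  case (Cons l ls)
  define T' where "T' z = cshift A l (T z)" for z
  have "linear T'"
    unfolding T'_def using linear_compose[OF \<open>linear T\<close> linear_cshift[OF A]] by (simp add: o_def)
  moreover have "T' (cmap A z) = cmap A (T' z)" for z
    by (simp add: T'_def Cons.prems cshift_cmap[OF A])
  moreover have "cshifts A ls (T' z) = 0" for z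
    using Cons.prems(4)[of z] by (simp add: T'_def)
  ultimately obtain Q' a' where Q': "bounded_bilinear Q'" "\<And>u v. Q' u v = Q' v u" "a' > (0::real)"
    "\<And>z. (norm (T' z))\<^sup>2 \<le> Q' z z" "\<And>z. Q' z (cmap A z) \<le> - a' * Q' z z"
    using Cons.IH[of T'] Cons.prems(1) by (metis list.set_intros(2))
  define r where "r = - Re l"
  have "r > 0" using Cons.prems(1) by (simp add: r_def)
  \<comment> \<open>Half of the decay \<open>a' * K * q\<close> found below then equals
    \<open>q / (2 * r)\<close>, exactly what the cross term leaves over.\<close>
  define K where "K = 1 / (a' * r)"
  have "K > 0" using \<open>r > 0\<close> Q' by (simp add: K_def)
  define a where "a = min (a' / 2) (r / 2)"
  have "a > 0" using \<open>r > 0\<close> Q' by (simp add: a_def)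
  define Q where "Q u v = K * Q' u v + T u \<bullet> T v" for u v
  have bT: "bounded_linear T"
    by (simp add: linear_conv_bounded_linear[symmetric] Cons.prems)
  have "bounded_bilinear (\<lambda>u v. K * Q' u v)"
  proof -
    have "(\<lambda>u v. K * Q' u v) = (\<lambda>u. Q' (K *\<^sub>R u))"
      by (intro ext) (simp add: bounded_bilinear.scaleR_left[OF Q'(1)])
    then show ?thesis
      using bounded_bilinear.comp1[OF Q'(1) bounded_linear_scaleR_right[of K]] by simp
  qed
  moreover have "bounded_bilinear (\<lambda>u v. T u \<bullet> T v)"
    using bounded_bilinear.comp[OF bounded_bilinear_inner bT bT] .
  ultimately have "bounded_bilinear Q"
    unfolding Q_def by (rule bounded_bilinear_plus)
  moreover have "Q u v = Q v u" for u v
    by (simp add: Q_def Q'(2)[of u] inner_commute)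
  moreover have "(norm (T z))\<^sup>2 \<le> Q z z" for z
  proof -
    have "0 \<le> Q' z z" using Q'(4)[of z] by (smt (verit) zero_le_power2)
    then show ?thesis using \<open>K > 0\<close> by (simp add: Q_def power2_norm_eq_inner)
  qed
  moreover have "Q z (cmap A z) \<le> - a * Q z z" for z
  proof -
    define q n where "q = Q' z z" and "n = norm (T z)"
    have q0: "(norm (T' z))\<^sup>2 \<le> q" unfolding q_def by (rule Q')
    then have q: "0 \<le> q" by (smt (verit) zero_le_power2)
    have n2: "T z \<bullet> T z = n\<^sup>2" by (simp add: n_def power2_norm_eq_inner)
    have "T z \<bullet> T (cmap A z) = T z \<bullet> (cscale l (T z) + T' z)"
      by (simp add: Cons.prems T'_def cshift_def)
    also have "\<dots> = - r * n\<^sup>2 + T z \<bullet> T' z"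
      by (simp add: inner_add_right inner_cscale_self r_def n2)
    also have "T z \<bullet> T' z \<le> n * norm (T' z)"
      unfolding n_def by (rule norm_cauchy_schwarz)
    \<comment> \<open>Young's inequality, weighted so that the cross term uses up only half of the
      decay \<open>r * n\<^sup>2\<close>.\<close>
    also have "n * norm (T' z) \<le> r / 2 * n\<^sup>2 + (norm (T' z))\<^sup>2 / (2 * r)"
    proof -
      have "0 \<le> (r * n - norm (T' z))\<^sup>2 / (2 * r)" using \<open>r > 0\<close> by simp
      also have "\<dots> = r / 2 * n\<^sup>2 + (norm (T' z))\<^sup>2 / (2 * r) - n * norm (T' z)"
        using \<open>r > 0\<close> by (simp add: field_simps power2_eq_square)
      finally show ?thesis by simp
    qed
    also have "(norm (T' z))\<^sup>2 / (2 * r) \<le> q / (2 * r)"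
      using q0 \<open>r > 0\<close> by (simp add: divide_right_mono)
    finally have 1: "T z \<bullet> T (cmap A z) \<le> - (r / 2) * n\<^sup>2 + q / (2 * r)" by simp
    have "K * Q' z (cmap A z) \<le> K * (- a' * q)"
      unfolding q_def using \<open>K > 0\<close> Q'(5)[of z] by (intro mult_left_mono) auto
    also have "\<dots> = - (a' / 2) * (K * q) - q / (2 * r)"
      using \<open>a' > 0\<close> \<open>r > 0\<close> by (simp add: K_def field_simps)
    finally have "Q z (cmap A z) \<le> - (a' / 2) * (K * q) - (r / 2) * n\<^sup>2"
      using 1 by (simp add: Q_def)
    also have "\<dots> \<le> - a * (K * q) - a * n\<^sup>2"
    proof -
      have "a * (K * q) \<le> (a' / 2) * (K * q)"
        using q \<open>K > 0\<close> by (intro mult_right_mono) (auto simp: a_def)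
      moreover have "a * n\<^sup>2 \<le> r / 2 * n\<^sup>2"
        by (intro mult_right_mono) (auto simp: a_def)
      ultimately show ?thesis by simp
    qed
    also have "\<dots> = - a * Q z z"
      by (simp add: Q_def q_def n2 algebra_simps)
    finally show ?thesis .
  qed
  ultimately show ?case using \<open>a > 0\<close> by blast
qed

text \<open>With \<open>T\<close> the identity, the previous construction gives a form on the
  complexification, which is then restricted to the real vectors \<open>(u, 0)\<close>.\<close>

theorem lyapunov_form_exists:
  fixes A :: "'a::euclidean_space \<Rightarrow> 'a"
  assumes A: "linear A"
    and eig: "\<And>l z. z \<noteq> 0 \<Longrightarrow> cmap A z = cscale l z \<Longrightarrow> Re l < 0"
  obtains Q a where "bounded_bilinear Q" "\<And>u v. Q u v = Q v u" "a > (0::real)"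
    "\<And>u. (norm u)\<^sup>2 \<le> Q u u" "\<And>u. Q u (A u) \<le> - a * Q u u"
proof -
  obtain ls where ls: "\<And>z. cshifts A ls z = 0"
    "\<And>l. l \<in> set ls \<Longrightarrow> \<exists>z. z \<noteq> 0 \<and> cmap A z = cscale l z"
    using cshifts_annihilate_eigenvalues[OF A] by blast
  have neg: "\<And>l. l \<in> set ls \<Longrightarrow> Re l < 0"
    using ls(2) eig by blast
  have "\<exists>Q a. bounded_bilinear Q \<and> (\<forall>u v. Q u v = Q v u) \<and> a > (0::real) \<and>
    (\<forall>z :: 'a \<times> 'a. (norm z)\<^sup>2 \<le> Q z z \<and> Q z (cmap A z) \<le> - a * Q z z)"
    by (rule lyapunov_form_cshifts[OF A, where T = "\<lambda>z. z" and ls = ls])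
      (rule neg ls linear_ident refl | assumption)+
  then obtain Q a where Q: "bounded_bilinear Q"
    "\<And>u v. Q u v = Q v u" "a > (0::real)"
    "\<And>z :: 'a \<times> 'a. (norm z)\<^sup>2 \<le> Q z z" "\<And>z. Q z (cmap A z) \<le> - a * Q z z"
    by metis
  have bl: "bounded_linear (\<lambda>u :: 'a. (u, 0 :: 'a))"
    by (intro bounded_linear_Pair bounded_linear_ident bounded_linear_zero)
  show ?thesis
  proof (rule that[of "\<lambda>u v. Q (u, 0) (v, 0)" a])
    show "bounded_bilinear (\<lambda>u v. Q (u, 0) (v, 0))"
      by (rule bounded_bilinear.comp[OF Q(1) bl bl])
    show "(norm u)\<^sup>2 \<le> Q (u, 0) (u, 0)" for u
      using Q(4)[of "(u, 0)"] by (simp add: norm_Pair)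
    show "Q (u, 0) (A u, 0) \<le> - a * Q (u, 0) (u, 0)" for u
      using Q(5)[of "(u, 0)"] by (simp add: cmap_def linear_0[OF A])
  qed (use Q in auto)
qed


section \<open>Linearised stability and global solutions\<close>

lemma has_vector_derivative_at_within_0_atLeast:
  assumes "(x has_vector_derivative v) (at t within {0..})" "(t::real) > 0"
  shows "(x has_vector_derivative v) (at t)"
  using assms at_within_interior[of t "{0::real..}"] by (simp add: interior_real_atLeast)

text \<open>Decay is known only below the level \<open>c\<close>, so \<open>u\<close> is first shown
  to remain there: up to the first time at which \<open>c\<close> is reached, \<open>u\<close> would
  have been nonincreasing. Then \<open>exp (a * t) * u t\<close> is nonincreasing
  throughout.\<close>

lemma exp_decay_if_decay_below:
  fixes u u' :: "real \<Rightarrow> real"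
  assumes der: "\<And>t. t \<ge> 0 \<Longrightarrow> (u has_vector_derivative u' t) (at t within {0..})"
    and nonneg: "\<And>t. t \<ge> 0 \<Longrightarrow> 0 \<le> u t"
    and decay: "\<And>t. t \<ge> 0 \<Longrightarrow> u t < c \<Longrightarrow> u' t \<le> - a * u t"
    and "u 0 < c" "a \<ge> 0" "t \<ge> 0"
  shows "u t \<le> exp (- a * t) * u 0"
proof -
  have cont: "continuous_on {0..} u"
    using der by (intro continuous_on_vector_derivative) auto
  have DERIV: "DERIV u t :> u' t" if "t > 0" for t
    using has_vector_derivative_at_within_0_atLeast[OF der[of t] that] that
    by (simp add: has_real_derivative_iff_has_vector_derivative)
  have below: "u t < c" if "t \<ge> 0" for t
  proof (rule ccontr)
    assume "\<not> u t < c"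
    define S where "S = {0..t} \<inter> u -` {c..}"
    have cS: "closed S"
      unfolding S_def
      by (intro continuous_closed_preimage continuous_on_subset[OF cont]) auto
    have "S \<noteq> {}" "bdd_below S" using \<open>\<not> u t < c\<close> \<open>t \<ge> 0\<close> by (auto simp: S_def)
    then have "Inf S \<in> S" by (rule closed_contains_Inf[OF _ _ cS])
    define s where "s = Inf S"
    have s: "0 \<le> s" "u s \<ge> c" using \<open>Inf S \<in> S\<close> by (auto simp: S_def s_def)
    have before: "u r < c" if "0 \<le> r" "r < s" for r
    proof (rule ccontr)
      assume "\<not> u r < c"
      then have "r \<in> S" using that \<open>Inf S \<in> S\<close> by (auto simp: S_def s_def)
      then have "s \<le> r" unfolding s_def using \<open>bdd_below S\<close> by (rule cInf_lower)
      with that show False by simp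
    qed
    have "u s \<le> u 0"
    proof (rule DERIV_nonpos_imp_decreasing_open[OF s(1)])
      fix r assume r: "0 < r" "r < s"
      have "u' r \<le> - a * u r" using r before by (intro decay) auto
      also have "\<dots> \<le> 0" using \<open>a \<ge> 0\<close> nonneg[of r] r by simp
      finally show "\<exists>y. DERIV u r :> y \<and> y \<le> 0" using DERIV r(1) by blast
    qed (rule continuous_on_subset[OF cont], auto)
    with s \<open>u 0 < c\<close> show False by simp
  qed
  have "exp (a * t) * u t \<le> exp (a * 0) * u 0"
  proof (rule DERIV_nonpos_imp_decreasing_open[OF \<open>t \<ge> 0\<close>])
    fix r assume r: "0 < r" "r < t"
    have "DERIV (\<lambda>r. exp (a * r) * u r) r :> exp (a * r) * (a * u r + u' r)"
      by (auto intro!: derivative_eq_intros DERIV r simp: algebra_simps)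
    moreover have "exp (a * r) * (a * u r + u' r) \<le> 0"
      using decay[of r] below[of r] r by (intro mult_nonneg_nonpos) auto
    ultimately show "\<exists>y. DERIV (\<lambda>r. exp (a * r) * u r) r :> y \<and> y \<le> 0" by blast
  qed (intro continuous_intros continuous_on_subset[OF cont], auto)
  then show ?thesis by (simp add: exp_minus field_simps)
qed

text \<open>\<open>Q (x - p) (x - p)\<close> is a Lyapunov function: near \<open>p\<close> the
  linearisation error costs at most half of the decay rate. One exponential bound gives both
  stability and attraction; existence of solutions is a hypothesis because
  \<open>lyapunov_stable\<close> includes it.\<close>

theorem linearized_stability:
  fixes f :: "'a::real_normed_vector \<Rightarrow> 'a" and Q :: "'a \<Rightarrow> 'a \<Rightarrow> real"
  assumes Q: "bounded_bilinear Q" "\<And>u v. Q u v = Q v u" "\<And>u. (norm u)\<^sup>2 \<le> Q u u"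
    and "a > 0"
    and f: "(f has_derivative f') (at p)" "f p = 0"
    and decay: "\<And>x. x \<in> S \<Longrightarrow> Q (x - p) (f' (x - p)) \<le> - a * Q (x - p) (x - p)"
    and ex: "\<And>x0. x0 \<in> S \<Longrightarrow> \<exists>x. is_solution f S x \<and> x 0 = x0"
  shows "locally_asymptotically_stable f S p"
proof -
  obtain K where K: "K > 0" "\<And>u v. norm (Q u v) \<le> norm u * norm v * K"
    using bounded_bilinear.pos_bounded[OF Q(1)] by auto
  have Q0: "0 \<le> Q u u" for u using Q(3)[of u] by (smt (verit) zero_le_power2)
  \<comment> \<open>With this \<open>e\<close> the linearisation error contributes at most
    \<open>K * e = a / 2\<close> times the squared distance from \<open>p\<close>.\<close>
  define e where "e = a / (2 * K)"
  have "e > 0" using \<open>a > 0\<close> \<open>K > 0\<close> by (simp add: e_def)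
  then obtain \<rho> where \<rho>: "\<rho> > 0"
    "\<And>x. norm (x - p) < \<rho> \<Longrightarrow> norm (f x - f' (x - p)) \<le> e * norm (x - p)"
    using f unfolding has_derivative_at_alt by auto
  have local_decay: "Q (x - p) (f x) \<le> - (a / 2) * Q (x - p) (x - p)"
    if "x \<in> S" "norm (x - p) < \<rho>" for x
  proof -
    interpret bounded_bilinear Q by (rule Q)
    let ?h = "x - p"
    have "Q ?h (f x) = Q ?h (f' ?h) + Q ?h (f x - f' ?h)"
      by (simp add: diff_right)
    also have "Q ?h (f x - f' ?h) \<le> norm ?h * (e * norm ?h) * K"
      using K(2)[of ?h "f x - f' ?h"] \<rho>(2)[OF that(2)] K(1)
        mult_left_mono[of "norm (f x - f' ?h)" "e * norm ?h" "norm ?h"]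
      by (smt (verit) mult_right_mono norm_ge_zero real_norm_def)
    also have "\<dots> = (a / 2) * (norm ?h)\<^sup>2"
      using K(1) by (simp add: e_def power2_eq_square)
    also have "\<dots> \<le> (a / 2) * Q ?h ?h"
      using Q(3)[of ?h] \<open>a > 0\<close> by (intro mult_left_mono) auto
    finally show ?thesis using decay[OF that(1)] by simp
  qed
  \<comment> \<open>As \<open>Q\<close> dominates the squared norm, the sublevel set at
    \<open>\<rho>\<^sup>2\<close> lies in the ball where the local decay holds, and solutions that
    start in it stay in it.\<close>
  have trap: "(norm (x t - p))\<^sup>2 \<le> exp (- a * t) * Q (x 0 - p) (x 0 - p)"
    if x: "is_solution f S x" and x0: "Q (x 0 - p) (x 0 - p) < \<rho>\<^sup>2" and "t \<ge> 0" for x t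
  proof -
    define u where "u t = Q (x t - p) (x t - p)" for t
    have "u t \<le> exp (- a * t) * u 0"
    proof (rule exp_decay_if_decay_below[where u' = "\<lambda>t. 2 * Q (x t - p) (f (x t))" and c = "\<rho>\<^sup>2"])
      fix t :: real assume t: "t \<ge> 0"
      have xd: "(x has_vector_derivative f (x t)) (at t within {0..})" and xS: "x t \<in> S"
        using x t by (auto simp: is_solution_def)
      have "((\<lambda>t. x t - p) has_vector_derivative f (x t)) (at t within {0..})"
        by (auto intro!: derivative_eq_intros xd)
      from bounded_bilinear.has_vector_derivative[OF Q(1) this this]
      show "(u has_vector_derivative 2 * Q (x t - p) (f (x t))) (at t within {0..})"
        unfolding u_def by (simp add: Q(2)[of "f (x t)"])
      show "0 \<le> u t" by (simp add: u_def Q0)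
      assume "u t < \<rho>\<^sup>2"
      then have "(norm (x t - p))\<^sup>2 < \<rho>\<^sup>2" using Q(3)[of "x t - p"] by (simp add: u_def)
      then have "norm (x t - p) < \<rho>" using \<rho>(1) by (simp add: power_less_imp_less_base)
      from local_decay[OF xS this]
      show "2 * Q (x t - p) (f (x t)) \<le> - a * u t" by (simp add: u_def)
    qed (use x0 \<open>a > 0\<close> \<open>t \<ge> 0\<close> in \<open>auto simp: u_def\<close>)
    then show ?thesis using Q(3)[of "x t - p"] by (simp add: u_def)
  qed
  \<comment> \<open>Conversely, the bound \<open>K\<close> makes \<open>Q\<close> small near
    \<open>p\<close>; the radius \<open>s\<close> solves
    \<open>K * s\<^sup>2 = r\<^sup>2\<close>.\<close>
  have near: "\<exists>\<eta>>0. \<forall>x. dist x p < \<eta> \<longrightarrow> Q (x - p) (x - p) < r\<^sup>2" if "r > 0" for r :: real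
  proof (intro exI[of _ "r / sqrt K"] conjI allI impI)
    show "r / sqrt K > 0" using that K by simp
    fix x assume "dist x p < r / sqrt K"
    then have "(norm (x - p))\<^sup>2 < (r / sqrt K)\<^sup>2"
      by (intro power_strict_mono) (auto simp: dist_norm)
    also have "\<dots> = r\<^sup>2 / K" using K by (simp add: power_divide)
    finally have "(norm (x - p))\<^sup>2 * K < r\<^sup>2" using K by (simp add: field_simps)
    then show "Q (x - p) (x - p) < r\<^sup>2"
      using K(2)[of "x - p" "x - p"] by (simp add: power2_eq_square)
  qed
  show ?thesis
    unfolding locally_asymptotically_stable_def
  proof
    show "lyapunov_stable f S p"
      unfolding lyapunov_stable_def
    proof (intro allI impI)
      fix \<epsilon> :: real assume "\<epsilon> > 0"
      \<comment> \<open>The minimum keeps solutions within \<open>\<epsilon>\<close> and also in the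
        region where \<open>trap\<close> applies.\<close>
      then obtain \<eta> where \<eta>: "\<eta> > 0" "\<And>x. dist x p < \<eta> \<Longrightarrow> Q (x - p) (x - p) < (min \<epsilon> \<rho>)\<^sup>2"
        using near[of "min \<epsilon> \<rho>"] \<rho>(1) by auto
      show "\<exists>\<eta>>0. \<forall>x0\<in>S. dist x0 p < \<eta> \<longrightarrow> (\<exists>x. is_solution f S x \<and> x 0 = x0) \<and>
        (\<forall>x. is_solution f S x \<and> x 0 = x0 \<longrightarrow> (\<forall>t\<ge>0. dist (x t) p < \<epsilon>))"
      proof (intro exI[of _ \<eta>] conjI ballI impI allI)
        fix x0 x and t :: real
        assume *: "x0 \<in> S" "dist x0 p < \<eta>" "is_solution f S x \<and> x 0 = x0" "0 \<le> t"
        then have q0: "Q (x 0 - p) (x 0 - p) < (min \<epsilon> \<rho>)\<^sup>2" using \<eta>(2) by simp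
        have "(min \<epsilon> \<rho>)\<^sup>2 \<le> \<rho>\<^sup>2" using \<rho>(1) \<open>\<epsilon> > 0\<close> by (intro power_mono) auto
        with q0 have "(norm (x t - p))\<^sup>2 \<le> exp (- a * t) * Q (x 0 - p) (x 0 - p)"
          using trap * by force
        moreover have "exp (- a * t) * Q (x 0 - p) (x 0 - p) \<le> 1 * Q (x 0 - p) (x 0 - p)"
          using \<open>a > 0\<close> \<open>0 \<le> t\<close> Q0 by (intro mult_right_mono) auto
        ultimately have "(norm (x t - p))\<^sup>2 < (min \<epsilon> \<rho>)\<^sup>2" using q0 by simp
        then have "norm (x t - p) < min \<epsilon> \<rho>"
          by (rule power_less_imp_less_base) (use \<rho>(1) \<open>\<epsilon> > 0\<close> in simp)
        then show "dist (x t) p < \<epsilon>" by (simp add: dist_norm)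
      qed (rule \<eta>(1) ex | assumption)+
    qed
    obtain \<eta> where \<eta>: "\<eta> > 0" "\<And>x. dist x p < \<eta> \<Longrightarrow> Q (x - p) (x - p) < \<rho>\<^sup>2"
      using near[OF \<rho>(1)] by blast
    show "locally_attractive f S p"
      unfolding locally_attractive_def
    proof (intro exI[of _ \<eta>] conjI allI impI)
      fix x assume x: "is_solution f S x \<and> dist (x 0) p < \<eta>"
      define C where "C = Q (x 0 - p) (x 0 - p)"
      have "LIM t at_top. a * t :> at_top"
        using \<open>a > 0\<close> by (intro filterlim_tendsto_pos_mult_at_top[OF tendsto_const] filterlim_ident)
      then have "((\<lambda>t. exp (- (a * t))) \<longlongrightarrow> 0) at_top"
        by (intro filterlim_compose[OF exp_at_bot]) (simp add: filterlim_uminus_at_bot)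
      then have "((\<lambda>t. exp (- a * t) * C) \<longlongrightarrow> 0) at_top"
        by (simp add: tendsto_mult_left_zero)
      moreover have "\<forall>\<^sub>F t in at_top. norm ((norm (x t - p))\<^sup>2) \<le> exp (- a * t) * C"
        using eventually_ge_at_top[of 0] by eventually_elim (use trap \<eta> x in \<open>auto simp: C_def\<close>)
      ultimately have "((\<lambda>t. (norm (x t - p))\<^sup>2) \<longlongrightarrow> 0) at_top"
        by (rule Lim_null_comparison[rotated])
      then have "((\<lambda>t. sqrt ((norm (x t - p))\<^sup>2)) \<longlongrightarrow> sqrt 0) at_top"
        by (rule tendsto_real_sqrt)
      then show "(x \<longlongrightarrow> p) at_top"
        by (simp add: tendsto_dist_iff[of x] dist_norm)
    qed (use \<eta> in auto)
  qed
qed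

section \<open>Global solutions of Lipschitz equations\<close>

lemma integral_has_vector_derivative_atLeast:
  fixes g :: "real \<Rightarrow> 'a::banach"
  assumes "continuous_on {0..} g" "t \<ge> 0"
  shows "((\<lambda>s. integral {0..s} g) has_vector_derivative g t) (at t within {0..})"
proof -
  have "((\<lambda>s. integral {0..s} g) has_vector_derivative g t) (at t within {0..t + 1})"
    using assms by (intro integral_has_vector_derivative continuous_on_subset[OF assms(1)]) auto
  also have "at t within {0..t + 1} = at t within {0..}"
    by (rule at_within_nhd[of _ "{..<t + 1}"]) auto
  finally show ?thesis .
qed

text \<open>Integrating growth of order \<open>exp (k * r)\<close> and weighting by
  \<open>exp (- k * s)\<close> gains a factor \<open>1 / k\<close>, which for large \<open>k\<close>
  makes the Picard operator a contraction.\<close>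

lemma norm_integral_exp_le:
  fixes g :: "real \<Rightarrow> 'a::banach"
  assumes "continuous_on {0..} g" "k > 0" "s \<ge> 0" "C \<ge> 0"
    and "\<And>r. r \<ge> 0 \<Longrightarrow> norm (g r) \<le> C * exp (k * r)"
  shows "norm (exp (- k * s) *\<^sub>R integral {0..s} g) \<le> C / k"
proof -
  have I: "((\<lambda>r. C * exp (k * r)) has_integral (C / k * exp (k * s) - C / k * exp (k * 0))) {0..s}"
    using \<open>k > 0\<close> \<open>s \<ge> 0\<close>
    by (intro fundamental_theorem_of_calculus)
      (auto intro!: derivative_eq_intros
        simp: has_real_derivative_iff_has_vector_derivative[symmetric])
  have "norm (integral {0..s} g) \<le> integral {0..s} (\<lambda>r. C * exp (k * r))"
    using assms I
    by (intro integral_norm_bound_integral integrable_continuous_real continuous_on_subset[OF assms(1)])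
      (auto simp: has_integral_integrable intro!: continuous_intros)
  also have "\<dots> = C / k * exp (k * s) - C / k"
    using integral_unique[OF I] by simp
  also have "\<dots> \<le> C / k * exp (k * s)"
    using assms by simp
  finally have "exp (- k * s) * norm (integral {0..s} g) \<le> exp (- k * s) * (C / k * exp (k * s))"
    by (intro mult_left_mono) auto
  then show ?thesis by (simp add: exp_minus field_simps)
qed

text \<open>
  Picard iteration for \<open>u t = exp (- k * t) *\<^sub>R x t\<close> in the space of bounded continuous functions;
  the weight makes it a contraction on the whole half line.
\<close>

theorem lipschitz_global_solution:
  fixes f :: "'a::banach \<Rightarrow> 'a"
  assumes "L-lipschitz_on UNIV f"
  shows "\<exists>x. is_solution f UNIV x \<and> x 0 = x0"
proof -
  have L: "L \<ge> 0" "\<And>x y. norm (f x - f y) \<le> L * norm (x - y)"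
    using assms by (auto simp: lipschitz_on_def dist_norm)
  have cf: "continuous_on X f" for X
    using lipschitz_on_continuous_on[OF assms] continuous_on_subset by blast
  \<comment> \<open>Any \<open>k\<close> above \<open>L\<close> would do, the contraction constant
    being \<open>L / k\<close>.\<close>
  define k where "k = L + 1"
  have k: "k > 0" "L / k < 1" using L by (auto simp: k_def)
  define g where "g u r = f (exp (k * r) *\<^sub>R apply_bcontfun u r)" for u :: "real \<Rightarrow>\<^sub>C 'a" and r
  have cg: "continuous_on X (g u)" for X u
    unfolding g_def by (intro continuous_on_compose2[OF cf[of UNIV]] continuous_intros) auto
  \<comment> \<open>The Picard operator for the initial value \<open>x0\<close>, written for the
    weighted unknown.\<close>
  define I where "I u s = exp (- k * s) *\<^sub>R (x0 + integral {0..s} (g u))" for u s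
  have cI: "continuous_on {0..} (I u)" for u
    unfolding I_def
    by (intro continuous_intros continuous_on_vector_derivative[of "{0..}" _ "g u"]
        integral_has_vector_derivative_atLeast cg) auto
  have bI: "norm (I u s) \<le> norm x0 + (norm (f 0) + L * norm u) / k" if "s \<ge> 0" for u s
  proof -
    have "norm (exp (- k * s) *\<^sub>R integral {0..s} (g u)) \<le> (norm (f 0) + L * norm u) / k"
    proof (rule norm_integral_exp_le[OF cg k(1) that])
      fix r :: real assume "r \<ge> 0"
      have "norm (g u r) \<le> norm (f 0) + L * norm (exp (k * r) *\<^sub>R apply_bcontfun u r)"
        using L(2)[of "exp (k * r) *\<^sub>R apply_bcontfun u r" 0] norm_triangle_sub[of "g u r" "f 0"]
        by (simp add: g_def)
      also have "\<dots> \<le> norm (f 0) * exp (k * r) + L * (norm u * exp (k * r))"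
        using k \<open>r \<ge> 0\<close> L norm_bounded[of u r]
        by (intro add_mono mult_left_mono) (auto simp: mult_le_cancel_left1 mult.commute)
      finally show "norm (g u r) \<le> (norm (f 0) + L * norm u) * exp (k * r)"
        by (simp add: algebra_simps)
    qed (use L in auto)
    moreover have "norm (exp (- k * s) *\<^sub>R x0) \<le> norm x0"
      using k that by (simp add: mult_left_le_one_le)
    ultimately show ?thesis
      unfolding I_def scaleR_add_right by (rule norm_triangle_mono[rotated])
  qed
  \<comment> \<open>Bounded continuous functions are taken on the whole real line here, so the
    operator is extended to negative times by its value at 0.\<close>
  define T where "T u = Bcontfun (\<lambda>t. I u (max 0 t))" for u
  have T: "apply_bcontfun (T u) t = I u (max 0 t)" for u t
  proof -
    have "(\<lambda>t. I u (max 0 t)) \<in> bcontfun"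
      by (rule bcontfun_normI[OF _ bI])
        (auto intro!: continuous_on_compose2[OF cI] continuous_intros)
    then show ?thesis by (simp add: T_def Bcontfun_inverse)
  qed
  have "dist (T u) (T v) \<le> L / k * dist u v" for u v
  proof (rule dist_bound)
    fix t :: real
    define s where "s = max 0 t"
    have "s \<ge> 0" by (simp add: s_def)
    have int: "g u integrable_on {0..s}" for u
      by (intro integrable_continuous_real cg)
    have "I u s - I v s = exp (- k * s) *\<^sub>R (integral {0..s} (g u) - integral {0..s} (g v))"
      by (simp add: I_def algebra_simps)
    also have "integral {0..s} (g u) - integral {0..s} (g v) = integral {0..s} (\<lambda>r. g u r - g v r)"
      by (simp add: integral_diff int)
    also have "norm (exp (- k * s) *\<^sub>R \<dots>) \<le> L * dist u v / k"
    proof (rule norm_integral_exp_le[OF _ k(1) \<open>s \<ge> 0\<close>])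
      fix r :: real
      have "norm (g u r - g v r) \<le> L * (exp (k * r) * norm (apply_bcontfun u r - apply_bcontfun v r))"
        using L(2)[of "exp (k * r) *\<^sub>R apply_bcontfun u r" "exp (k * r) *\<^sub>R apply_bcontfun v r"]
        by (simp add: g_def scaleR_diff_right[symmetric])
      also have "\<dots> \<le> L * (exp (k * r) * dist u v)"
        using dist_bounded[of u r v] L(1) by (intro mult_left_mono) (auto simp: dist_norm)
      finally show "norm (g u r - g v r) \<le> L * dist u v * exp (k * r)"
        by (simp add: mult_ac)
    qed (auto intro!: continuous_intros cg mult_nonneg_nonneg L)
    finally show "dist (apply_bcontfun (T u) t) (apply_bcontfun (T v) t) \<le> L / k * dist u v"
      unfolding T s_def[symmetric] dist_norm[of "I u s"] by simp
  qed
  then obtain u where u: "T u = u"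
    using banach_fix_type[of "L / k" T] k L by (metis divide_nonneg_pos)
  define x where "x t = exp (k * t) *\<^sub>R apply_bcontfun u t" for t
  have gx: "g u = (\<lambda>r. f (x r))"
    by (simp add: g_def x_def fun_eq_iff)
  have x: "x t = x0 + integral {0..t} (g u)" if "t \<ge> 0" for t
  proof -
    have "apply_bcontfun u t = I u t"
      using T[of u t] u that by (simp add: max_def)
    then show ?thesis by (simp add: x_def I_def exp_minus)
  qed
  have "(x has_vector_derivative f (x t)) (at t within {0..})" if "t \<ge> 0" for t
  proof -
    have "((\<lambda>s. x0 + integral {0..s} (g u)) has_vector_derivative g u t) (at t within {0..})"
      using that by (auto intro!: derivative_eq_intros integral_has_vector_derivative_atLeast cg)
    then have "(x has_vector_derivative g u t) (at t within {0..})"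
      by (rule has_vector_derivative_transform[rotated 2]) (use that x in auto)
    then show ?thesis by (simp add: gx)
  qed
  moreover have "x 0 = x0" by (simp add: x)
  ultimately show ?thesis by (auto simp: is_solution_def)
qed


section \<open>Weighted Laplacians and damped quadratic equations\<close>

text \<open>Minimum principle: at a node of minimal value all summands are nonpositive, hence zero,
  so every successor in \<open>E\<close> is minimal too; paths spread this to all nodes.\<close>

lemma superharmonic_constant:
  fixes w :: "'n::finite \<Rightarrow> 'n \<Rightarrow> real" and a :: "'n \<Rightarrow> real"
  assumes nonneg: "\<And>i k. i \<noteq> k \<Longrightarrow> 0 \<le> w i k"
    and pos: "\<And>i k. (i, k) \<in> E \<Longrightarrow> 0 < w i k"
    and conn: "\<And>i k. i \<noteq> k \<Longrightarrow> (i, k) \<in> E\<^sup>*"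
    and super: "\<And>i. 0 \<le> (\<Sum>k\<in>UNIV. w i k * (a i - a k))"
  shows "a i = a k"
proof -
  define b where "b = Min (range a)"
  have b: "b \<le> a k" for k by (simp add: b_def)
  have step: "a k = b" if "a i = b" "(i, k) \<in> E" for i k
  proof -
    have le: "w i k * (a i - a k) \<le> 0" for k
      using nonneg[of i k] b[of k] that(1) by (cases "i = k") (auto simp: mult_nonneg_nonpos)
    have "(\<Sum>k\<in>UNIV. - (w i k * (a i - a k))) = 0"
      using super[of i] sum_nonpos[of UNIV "\<lambda>k. w i k * (a i - a k)"] le
      by (simp add: sum_negf)
    then have "- (w i k * (a i - a k)) = 0"
      using le by (subst (asm) sum_nonneg_eq_0_iff) auto
    then show ?thesis using pos[OF that(2)] that(1) by simp
  qed
  have "b \<in> range a" unfolding b_def by (rule Min_in) auto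
  then obtain j where j: "a j = b" by auto
  have "a k = b" for k
  proof (cases "j = k")
    case False
    from conn[OF this] show ?thesis
      by (induction rule: rtrancl_induct) (use j step in auto)
  qed (use j in simp)
  then show ?thesis by simp
qed

text \<open>A Gershgorin argument at the node \<open>j\<close> of maximal modulus: the equation
  bounds \<open>cmod (\<mu> j + W) * cmod (a j)\<close> by \<open>W * cmod (a j)\<close>, which
  contradicts strict dominance unless \<open>a j = 0\<close>.\<close>

lemma dominant_laplacian_kernel:
  fixes w :: "'n::finite \<Rightarrow> 'n \<Rightarrow> real" and a \<mu> :: "'n \<Rightarrow> complex"
  assumes nonneg: "\<And>i k. i \<noteq> k \<Longrightarrow> 0 \<le> w i k"
    and dom: "\<And>i. (\<Sum>k\<in>UNIV - {i}. w i k) < cmod (\<mu> i + of_real (\<Sum>k\<in>UNIV - {i}. w i k))"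
    and eq: "\<And>i. \<mu> i * a i + (\<Sum>k\<in>UNIV. of_real (w i k) * (a i - a k)) = 0"
  shows "a i = 0"
proof -
  have "Max (range (\<lambda>i. cmod (a i))) \<in> range (\<lambda>i. cmod (a i))" by (rule Max_in) auto
  then obtain j where "Max (range (\<lambda>i. cmod (a i))) = cmod (a j)" by blast
  then have j: "cmod (a k) \<le> cmod (a j)" for k
    using Max_ge[of "range (\<lambda>i. cmod (a i))" "cmod (a k)"] by simp
  define W where "W = (\<Sum>k\<in>UNIV - {j}. w j k)"
  have "(\<Sum>k\<in>UNIV. of_real (w j k) * (a j - a k)) = (\<Sum>k\<in>UNIV - {j}. of_real (w j k) * (a j - a k))"
    by (simp add: sum.remove[of UNIV j])
  also have "\<dots> = of_real W * a j - (\<Sum>k\<in>UNIV - {j}. of_real (w j k) * a k)"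
    by (simp add: W_def right_diff_distrib sum_subtractf sum_distrib_right)
  finally have "(\<mu> j + of_real W) * a j = (\<Sum>k\<in>UNIV - {j}. of_real (w j k) * a k)"
    using eq[of j] by (simp add: algebra_simps add_eq_0_iff)
  then have "cmod (\<mu> j + of_real W) * cmod (a j) = cmod (\<Sum>k\<in>UNIV - {j}. of_real (w j k) * a k)"
    by (metis norm_mult)
  also have "\<dots> \<le> (\<Sum>k\<in>UNIV - {j}. w j k * cmod (a j))"
    using nonneg j by (intro sum_norm_le) (auto simp: norm_mult intro!: mult_mono)
  also have "\<dots> = W * cmod (a j)" by (simp add: W_def sum_distrib_right)
  finally have "cmod (a j) = 0"
    using dom[of j] by (simp add: W_def mult_le_cancel_right)
  then show ?thesis using j[of i] by simp
qed

text \<open>Exchanging the two indices and adding both versions turns each pair of terms into a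
  squared difference. The form is therefore real, and nonnegative if the off-diagonal weights
  are.\<close>

lemma laplacian_form_symmetric:
  fixes w :: "'n::finite \<Rightarrow> 'n \<Rightarrow> real" and a :: "'n \<Rightarrow> complex"
  assumes "\<And>i k. w i k = w k i"
  shows "2 * (\<Sum>i\<in>UNIV. (\<Sum>k\<in>UNIV. of_real (w i k) * (a i - a k)) * cnj (a i)) =
    of_real (\<Sum>i\<in>UNIV. \<Sum>k\<in>UNIV. w i k * (cmod (a i - a k))\<^sup>2)"
proof -
  let ?S = "\<Sum>i\<in>UNIV. \<Sum>k\<in>UNIV. of_real (w i k) * (a i - a k) * cnj (a i)"
  have "?S = (\<Sum>k\<in>UNIV. \<Sum>i\<in>UNIV. of_real (w i k) * (a i - a k) * cnj (a i))"
    by (rule sum.swap)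
  also have "\<dots> = (\<Sum>k\<in>UNIV. \<Sum>i\<in>UNIV. of_real (w k i) * (a i - a k) * cnj (a i))"
    by (intro sum.cong refl) (metis assms)
  finally have "?S + ?S = (\<Sum>i\<in>UNIV. \<Sum>k\<in>UNIV.
    of_real (w i k) * (a i - a k) * cnj (a i) + of_real (w i k) * (a k - a i) * cnj (a k))"
    by (simp add: sum.distrib)
  also have "\<dots> = (\<Sum>i\<in>UNIV. \<Sum>k\<in>UNIV. of_real (w i k * (cmod (a i - a k))\<^sup>2))"
    by (intro sum.cong refl) (simp only: of_real_mult complex_norm_square, simp add: algebra_simps)
  finally show ?thesis by (simp add: sum_distrib_right)
qed

section \<open>Scalar estimates for damped quadratics\<close>

lemma Re_neg_of_quadratic_root:
  assumes "of_real m * l\<^sup>2 + of_real d * l + of_real c = 0"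
    and "m > 0" "d > 0" "c \<ge> 0" "l \<noteq> 0"
  shows "Re l < 0"
proof (cases "Im l = 0")
  case True
  have "m * (Re l)\<^sup>2 + d * Re l + c = 0"
    using arg_cong[OF assms(1), of Re] True by (simp add: power2_eq_square)
  moreover have "Re l \<noteq> 0" using \<open>l \<noteq> 0\<close> True by (simp add: complex_eq_iff)
  then have "m * (Re l)\<^sup>2 > 0" using assms by simp
  ultimately have "d * Re l < 0" using assms(4) by linarith
  then show ?thesis using assms(3) by (simp add: mult_less_0_iff)
next
  case False
  \<comment> \<open>Off the real axis the imaginary part of the equation already determines
    \<open>Re l = - d / (2 * m)\<close>.\<close>
  have "Im l * (2 * m * Re l + d) = 0"
    using arg_cong[OF assms(1), of Im] by (simp add: power2_eq_square algebra_simps)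
  then have "2 * m * Re l = - d" using False by simp
  then have "m * Re l < 0" using assms(3) by linarith
  then show ?thesis using assms(2) by (simp add: mult_less_0_iff)
qed

text \<open>In the expanded squared modulus, with \<open>x\<close> and \<open>z\<close> the real and
  imaginary parts of \<open>l\<close>, only \<open>- 2 * c * m * z\<^sup>2\<close> can be negative;
  the bound on \<open>c\<close> lets the damping term \<open>d\<^sup>2 * z\<^sup>2\<close> absorb
  it.\<close>

lemma norm_gt_of_overdamped:
  assumes "m > 0" "d > 0" "0 \<le> c" "c \<le> d\<^sup>2 / (2 * m)" "Re l \<ge> 0" "l \<noteq> 0"
  shows "c < cmod (of_real m * l\<^sup>2 + of_real d * l + of_real c)"
proof -
  define x z where "x = Re l" and "z = Im l"
  have c: "2 * c * m \<le> d\<^sup>2" using assms by (simp add: field_simps)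
  have sq: "(cmod (of_real m * l\<^sup>2 + of_real d * l + of_real c))\<^sup>2 =
    c\<^sup>2 + (x\<^sup>2 + z\<^sup>2) * ((m * x + d)\<^sup>2 + m\<^sup>2 * z\<^sup>2) + 2 * c * m * x\<^sup>2 + 2 * c * d * x - 2 * c * m * z\<^sup>2"
  proof -
    have *: "Re (of_real m * l\<^sup>2 + of_real d * l + of_real c) = m * (x\<^sup>2 - z\<^sup>2) + d * x + c"
      "Im (of_real m * l\<^sup>2 + of_real d * l + of_real c) = 2 * m * x * z + d * z"
      by (simp_all add: x_def z_def power2_eq_square algebra_simps)
    show ?thesis
      unfolding cmod_power2 * by (simp add: power2_eq_square algebra_simps)
  qed
  have xz: "x \<ge> 0" "x\<^sup>2 + z\<^sup>2 > 0"
    using assms(5,6) by (auto simp: x_def z_def sum_power2_gt_zero_iff complex_eq_iff)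
  have "d\<^sup>2 \<le> (m * x + d)\<^sup>2" using assms xz by (intro power_mono) auto
  then have 1: "(x\<^sup>2 + z\<^sup>2) * (d\<^sup>2 + m\<^sup>2 * z\<^sup>2) \<le> (x\<^sup>2 + z\<^sup>2) * ((m * x + d)\<^sup>2 + m\<^sup>2 * z\<^sup>2)"
    using xz by (intro mult_left_mono) auto
  have 2: "2 * c * m * z\<^sup>2 \<le> d\<^sup>2 * z\<^sup>2" using c by (intro mult_right_mono) auto
  have 3: "0 < d\<^sup>2 * x\<^sup>2 + (x\<^sup>2 + z\<^sup>2) * (m\<^sup>2 * z\<^sup>2)"
  proof (cases "z = 0")
    case True
    then show ?thesis using xz assms by simp
  next
    case False
    then show ?thesis using xz assms by (intro add_nonneg_pos mult_pos_pos) auto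
  qed
  have "(x\<^sup>2 + z\<^sup>2) * (d\<^sup>2 + m\<^sup>2 * z\<^sup>2) = d\<^sup>2 * x\<^sup>2 + d\<^sup>2 * z\<^sup>2 + (x\<^sup>2 + z\<^sup>2) * (m\<^sup>2 * z\<^sup>2)"
    by (simp add: algebra_simps)
  moreover have "0 \<le> 2 * c * m * x\<^sup>2" "0 \<le> 2 * c * d * x" using assms xz by auto
  ultimately have "c\<^sup>2 < (cmod (of_real m * l\<^sup>2 + of_real d * l + of_real c))\<^sup>2"
    unfolding sq using 1 2 3 by linarith
  then show ?thesis by (rule power_less_imp_less_base) simp
qed

section \<open>Linearisation of the vector field\<close>

text \<open>The Jacobian in closed form as a map on pairs, so that stability can be argued in the
  space of the dynamics instead of on stacked vectors.\<close>

definition vf_deriv ::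
  "('n::finite \<Rightarrow> 'n \<Rightarrow> complex) \<Rightarrow> ('n \<Rightarrow> real) \<Rightarrow> ('n \<Rightarrow> real) \<Rightarrow> ('n \<Rightarrow> real) \<Rightarrow> real^'n
    \<Rightarrow> (real^'n) \<times> (real^'n) \<Rightarrow> (real^'n) \<times> (real^'n)" where
  "vf_deriv y V m d \<delta> h = (snd h, \<chi> i. (- (Lmat y V \<delta> *v fst h) $ i - d i * snd h $ i) / m i)"

lemma linear_vf_deriv: "linear (vf_deriv y V m d \<delta>)"
  by (rule linearI)
    (simp_all add: vf_deriv_def vec_eq_iff matrix_vector_right_distrib matrix_vector_mult_scaleR
      add_divide_distrib diff_divide_distrib algebra_simps)

lemma stack_inject: "stack x = stack z \<longleftrightarrow> x = z"
proof
  assume *: "stack x = stack z"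
  have "fst x $ i = fst z $ i" "snd x $ i = snd z $ i" for i
    using arg_cong[OF *, of "\<lambda>v. v $ Inl i"] arg_cong[OF *, of "\<lambda>v. v $ Inr i"]
    by (simp_all add: stack_def)
  then show "x = z" by (simp add: prod_eq_iff vec_eq_iff)
qed simp

lemma Jmat_mult_stack:
  assumes m: "\<And>i. m i \<noteq> 0"
  shows "Jmat y V m d \<delta> *v stack h = stack (vf_deriv y V m d \<delta> h)"
proof (rule vec_eq_iff[THEN iffD2], rule allI)
  have split: "(\<Sum>q\<in>UNIV. f q) = (\<Sum>k\<in>UNIV. f (Inl k)) + (\<Sum>k\<in>UNIV. f (Inr k))"
    for f :: "'a + 'a \<Rightarrow> real"
    by (subst UNIV_sum, subst sum.union_disjoint) (auto simp: sum.reindex)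
  have mul: "(diag_matrix a ** A) $ i $ k = a i * A $ i $ k"
    for a :: "'a \<Rightarrow> real" and A :: "real^'a^'a" and i k
    by (simp add: matrix_matrix_mult_def diag_matrix_def if_distrib[of "\<lambda>x. x * _"] cong: if_cong)
  fix p
  show "(Jmat y V m d \<delta> *v stack h) $ p = stack (vf_deriv y V m d \<delta> h) $ p"
  proof (cases p)
    case (Inl i)
    then show ?thesis
      by (simp add: stack_def vf_deriv_def Jmat_def block_matrix_def matrix_vector_mult_def split
          mat_def if_distrib[of "\<lambda>x. x * _"] cong: if_cong)
  next
    case (Inr i)
    have "(\<Sum>k\<in>UNIV. 1 / m i * diag_matrix d $ i $ k * snd h $ k) = d i * snd h $ i / m i"
      by (simp add: diag_matrix_def if_distrib[of "\<lambda>x. x * _"] if_distrib[of "\<lambda>x. _ * x"]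
          if_distrib[of "\<lambda>x. x / _"] cong: if_cong)
    moreover have "(\<Sum>k\<in>UNIV. 1 / m i * Lmat y V \<delta> $ i $ k * fst h $ k)
        = (Lmat y V \<delta> *v fst h) $ i / m i"
      by (simp add: sum_divide_distrib matrix_vector_mult_def)
    ultimately show ?thesis
      using Inr
      by (simp add: stack_def vf_deriv_def Jmat_def block_matrix_def matrix_vector_mult_def[of "block_matrix _ _ _ _"] split
          matrix_vector_mult_def[of "vec_lambda _"]
          matrix_inv_diag_matrix[OF m] mul sum_negf diff_divide_distrib)
  qed
qed

text \<open>\<open>stack\<close> is injective, so the derivative characterised through
  \<open>Jmat\<close> must be the explicit map.\<close>

lemma vector_field_has_derivative:
  fixes m :: "'n::finite \<Rightarrow> real"
  assumes "\<And>i. m i \<noteq> 0"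
  shows "(vector_field y V Ps m d has_derivative vf_deriv y V m d \<delta>) (at (\<delta>, \<omega>))"
proof -
  obtain F' where F': "(vector_field y V Ps m d has_derivative F') (at (\<delta>, \<omega>))"
    "\<And>h. stack (F' h) = Jmat y V m d \<delta> *v stack h"
    by (rule has_derivative_vector_field[where m = m and y = y and V = V and Ps = Ps and d = d
          and \<delta> = \<delta> and \<omega> = \<omega>, OF assms]) (rule that)
  have "F' = vf_deriv y V m d \<delta>"
  proof
    fix h
    have "stack (F' h) = stack (vf_deriv y V m d \<delta> h)"
      by (simp only: F'(2) Jmat_mult_stack[OF assms])
    then show "F' h = vf_deriv y V m d \<delta> h"
      by (simp only: stack_inject)
  qed
  with F' show ?thesis by simp
qed

lemma complexified_mult_nth:
  "(map_matrix complex_of_real A *v v) $ p =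
    Complex ((A *v (\<chi> q. Re (v $ q))) $ p) ((A *v (\<chi> q. Im (v $ q))) $ p)"
  by (simp add: complex_eq_iff matrix_vector_mult_def map_matrix_def)

text \<open>The upper block row makes the second half \<open>l\<close> times the first; the lower
  row, multiplied by \<open>m i\<close>, is the other equation. Together they form the quadratic
  eigenvalue problem.\<close>

lemma eigenspace_Jmat_iff:
  fixes m :: "'n::finite \<Rightarrow> real"
  assumes m: "\<And>i. m i \<noteq> 0"
  shows "v \<in> eigenspace (Jmat y V m d \<delta>) l \<longleftrightarrow>
    (\<forall>i. v $ Inr i = l * v $ Inl i \<and>
      (of_real (m i) * l + of_real (d i)) * v $ Inr i +
      (\<Sum>k\<in>UNIV. of_real (V i * V k * Ymod y i k * sin (Yang y i k - \<delta> $ i + \<delta> $ k)) *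
        (v $ Inl i - v $ Inl k)) = 0)"
proof -
  define S where "S i = (\<Sum>k\<in>UNIV. of_real (V i * V k * Ymod y i k *
      sin (Yang y i k - \<delta> $ i + \<delta> $ k)) * (v $ Inl i - v $ Inl k))" for i
  have st: "(\<chi> q. Re (v $ q)) = stack (\<chi> i. Re (v $ Inl i), \<chi> i. Re (v $ Inr i))"
    "(\<chi> q. Im (v $ q)) = stack (\<chi> i. Im (v $ Inl i), \<chi> i. Im (v $ Inr i))"
    by (auto simp: stack_def vec_eq_iff split: sum.split)
  have J: "(map_matrix complex_of_real (Jmat y V m d \<delta>) *v v) $ p =
    (case p of Inl i \<Rightarrow> v $ Inr i | Inr i \<Rightarrow> (- S i - of_real (d i) * v $ Inr i) / of_real (m i))" for p
    unfolding complexified_mult_nth st Jmat_mult_stack[OF m]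
    by (simp add: stack_def vf_deriv_def Lmat_mult_nth complex_eq_iff S_def sum_negf split: sum.split)
  have "v \<in> eigenspace (Jmat y V m d \<delta>) l \<longleftrightarrow> (\<forall>i. v $ Inr i = l * v $ Inl i) \<and>
    (\<forall>i. (- S i - of_real (d i) * v $ Inr i) / of_real (m i) = l * v $ Inr i)"
    unfolding eigenspace_def mem_Collect_eq vec_eq_iff J split_sum_all vector_smult_component by simp
  also have "\<dots> \<longleftrightarrow> (\<forall>i. v $ Inr i = l * v $ Inl i \<and>
      (of_real (m i) * l + of_real (d i)) * v $ Inr i + S i = 0)"
  proof -
    have "(- S i - of_real (d i) * v $ Inr i) / of_real (m i) = l * v $ Inr i \<longleftrightarrow>
      (of_real (m i) * l + of_real (d i)) * v $ Inr i + S i = 0" for i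
    proof -
      have eq: "(of_real (m i) * l + of_real (d i)) * v $ Inr i + S i =
        - ((- S i - of_real (d i) * v $ Inr i) - l * v $ Inr i * of_real (m i))"
        by (simp add: algebra_simps)
      show ?thesis unfolding eq using m[of i]
        by (simp only: nonzero_divide_eq_eq of_real_eq_0_iff not_False_eq_True
            neg_equal_0_iff_equal right_minus_eq)
    qed
    then show ?thesis by auto
  qed
  finally show ?thesis unfolding S_def .
qed

section \<open>Global Lipschitz bound for the vector field\<close>

lemma abs_cos_diff_le: "\<bar>cos a - cos b\<bar> \<le> \<bar>a - b\<bar>" for a b :: real
proof -
  have "\<bar>cos a - cos b\<bar> = 2 * \<bar>sin ((a + b) / 2)\<bar> * \<bar>sin ((b - a) / 2)\<bar>"
    by (simp add: cos_diff_cos abs_mult)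
  also have "\<dots> \<le> 2 * 1 * \<bar>(b - a) / 2\<bar>"
    by (intro mult_mono abs_sin_x_le_abs_x) auto
  finally show ?thesis by (simp add: abs_minus_commute)
qed

lemma Pe_lipschitz:
  "\<bar>Pe y V \<delta> $ i - Pe y V \<delta>' $ i\<bar> \<le> (\<Sum>k\<in>UNIV. 2 * \<bar>V i * V k * Ymod y i k\<bar>) * norm (\<delta> - \<delta>')"
proof -
  have "\<bar>Pe y V \<delta> $ i - Pe y V \<delta>' $ i\<bar> \<le> (\<Sum>k\<in>UNIV. \<bar>V i * V k * Ymod y i k\<bar> * (2 * norm (\<delta> - \<delta>')))"
    unfolding Pe_def vec_lambda_beta sum_subtractf[symmetric] right_diff_distrib[symmetric]
  proof (rule order_trans[OF sum_abs], intro sum_mono)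
    fix k
    have "\<bar>cos (Yang y i k - \<delta> $ i + \<delta> $ k) - cos (Yang y i k - \<delta>' $ i + \<delta>' $ k)\<bar>
      \<le> \<bar>(\<delta> - \<delta>') $ i\<bar> + \<bar>(\<delta> - \<delta>') $ k\<bar>"
      by (rule order_trans[OF abs_cos_diff_le]) simp
    also have "\<dots> \<le> 2 * norm (\<delta> - \<delta>')"
      using component_le_norm_cart[of "\<delta> - \<delta>'" i] component_le_norm_cart[of "\<delta> - \<delta>'" k] by linarith
    finally show "\<bar>V i * V k * Ymod y i k * (cos (Yang y i k - \<delta> $ i + \<delta> $ k) -
      cos (Yang y i k - \<delta>' $ i + \<delta>' $ k))\<bar> \<le> \<bar>V i * V k * Ymod y i k\<bar> * (2 * norm (\<delta> - \<delta>'))"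
      unfolding abs_mult[of "_ * _ * _"] by (intro mult_left_mono) auto
  qed
  then show ?thesis by (simp add: sum_distrib_left sum_distrib_right mult_ac)
qed

text \<open>Angles enter only through cosines and speeds only linearly, so one constant serves
  everywhere; this supplies solutions on the whole half line.\<close>

lemma vector_field_lipschitz: "\<exists>L. L-lipschitz_on UNIV (vector_field y V Ps m d)"
proof -
  define C where "C i = ((\<Sum>k\<in>UNIV. 2 * \<bar>V i * V k * Ymod y i k\<bar>) + \<bar>d i\<bar>) / \<bar>m i\<bar>" for i
  have C: "0 \<le> C i" for i by (auto simp: C_def intro!: sum_nonneg divide_nonneg_nonneg add_nonneg_nonneg)
  have "(1 + (\<Sum>i\<in>UNIV. C i))-lipschitz_on UNIV (vector_field y V Ps m d)"
  proof (rule lipschitz_onI)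
    fix x x' :: "(real^'a) \<times> (real^'a)"
    obtain \<delta> \<omega> \<delta>' \<omega>' where x: "x = (\<delta>, \<omega>)" "x' = (\<delta>', \<omega>')" by (cases x, cases x') auto
    have n: "norm (\<delta> - \<delta>') \<le> dist x x'" "norm (\<omega> - \<omega>') \<le> dist x x'"
      using dist_fst_le[of x x'] dist_snd_le[of x x'] by (simp_all add: x dist_norm)
    let ?F = "\<lambda>\<delta> \<omega>. \<chi> i. (Ps i - Pe y V \<delta> $ i - d i * \<omega> $ i) / m i"
    have comp: "\<bar>(?F \<delta> \<omega> - ?F \<delta>' \<omega>') $ i\<bar> \<le> C i * dist x x'" for i
    proof -
      have "\<bar>Pe y V \<delta> $ i - Pe y V \<delta>' $ i\<bar> \<le> (\<Sum>k\<in>UNIV. 2 * \<bar>V i * V k * Ymod y i k\<bar>) * dist x x'"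
        by (rule order_trans[OF Pe_lipschitz]) (intro mult_left_mono n sum_nonneg, auto)
      moreover have "\<bar>d i * (\<omega> $ i - \<omega>' $ i)\<bar> \<le> \<bar>d i\<bar> * dist x x'"
        unfolding abs_mult using component_le_norm_cart[of "\<omega> - \<omega>'" i] n(2)
        by (intro mult_left_mono) auto
      ultimately have "\<bar>Pe y V \<delta> $ i - Pe y V \<delta>' $ i\<bar> + \<bar>d i * (\<omega> $ i - \<omega>' $ i)\<bar>
        \<le> ((\<Sum>k\<in>UNIV. 2 * \<bar>V i * V k * Ymod y i k\<bar>) + \<bar>d i\<bar>) * dist x x'"
        by (simp add: distrib_right)
      then have "(\<bar>Pe y V \<delta> $ i - Pe y V \<delta>' $ i\<bar> + \<bar>d i * (\<omega> $ i - \<omega>' $ i)\<bar>) / \<bar>m i\<bar> \<le> C i * dist x x'"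
        unfolding C_def times_divide_eq_left by (intro divide_right_mono) auto
      moreover have "(?F \<delta> \<omega> - ?F \<delta>' \<omega>') $ i =
        - ((Pe y V \<delta> $ i - Pe y V \<delta>' $ i) + d i * (\<omega> $ i - \<omega>' $ i)) / m i"
        by (simp add: diff_divide_distrib add_divide_distrib right_diff_distrib)
      then have "\<bar>(?F \<delta> \<omega> - ?F \<delta>' \<omega>') $ i\<bar> =
        \<bar>(Pe y V \<delta> $ i - Pe y V \<delta>' $ i) + d i * (\<omega> $ i - \<omega>' $ i)\<bar> / \<bar>m i\<bar>"
        by (simp only: abs_divide abs_minus_cancel)
      moreover have "\<dots> \<le> (\<bar>Pe y V \<delta> $ i - Pe y V \<delta>' $ i\<bar> + \<bar>d i * (\<omega> $ i - \<omega>' $ i)\<bar>) / \<bar>m i\<bar>"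
        by (intro divide_right_mono abs_triangle_ineq abs_ge_zero)
      ultimately show ?thesis by linarith
    qed
    have "norm (?F \<delta> \<omega> - ?F \<delta>' \<omega>') \<le> (\<Sum>i\<in>UNIV. C i * dist x x')"
      by (rule order_trans[OF norm_le_l1_cart]) (intro sum_mono comp)
    then have "norm (\<omega> - \<omega>', ?F \<delta> \<omega> - ?F \<delta>' \<omega>') \<le> dist x x' + (\<Sum>i\<in>UNIV. C i * dist x x')"
      using n(2) norm_Pair_le[of "\<omega> - \<omega>'" "?F \<delta> \<omega> - ?F \<delta>' \<omega>'"] by linarith
    moreover have "vector_field y V Ps m d x - vector_field y V Ps m d x' =
      (\<omega> - \<omega>', ?F \<delta> \<omega> - ?F \<delta>' \<omega>')"
      by (simp add: x vector_field_def)
    ultimately show "dist (vector_field y V Ps m d x) (vector_field y V Ps m d x') \<le>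
      (1 + (\<Sum>i\<in>UNIV. C i)) * dist x x'"
      by (simp only: dist_norm[of "vector_field y V Ps m d x"] distrib_right sum_distrib_right mult_1)
  qed (simp add: sum_nonneg C)
  then show ?thesis by blast
qed

section \<open>Reference bus and uniform shifts\<close>

lemma linear_refer: "linear (refer r)"
  by (rule linearI) (auto simp: refer_def vec_eq_iff algebra_simps split: prod.splits)

lemma refer_idem [simp]: "refer r (refer r x) = refer r x"
  by (simp add: refer_def split: prod.splits)

lemma refer_vf_deriv_refer [simp]: "vf_deriv y V m d \<delta> (refer r h) = vf_deriv y V m d \<delta> h"
  by (simp add: vf_deriv_def refer_def Lmat_mult_nth vec_eq_iff algebra_simps split: prod.splits)

lemma Lmat_refer: "Lmat y V (fst (refer r x)) = Lmat y V (fst x)"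
  by (simp add: Lmat_def refer_def vec_eq_iff algebra_simps split: prod.splits)

text \<open>The tangent direction of the families of equilibria; \<open>refer r\<close> removes the
  multiple of it that brings the angle of \<open>r\<close> to zero.\<close>

definition shift_dir :: "(real^'n) \<times> (real^'n)" where
  "shift_dir = (\<chi> i. 1, 0)"

lemma diff_refer: "h - refer r h = (fst h $ r) *\<^sub>R shift_dir"
  by (cases h) (simp add: refer_def shift_dir_def vec_eq_iff)

lemma vf_deriv_shift_dir [simp]: "vf_deriv y V m d \<delta> shift_dir = 0"
  by (simp add: vf_deriv_def shift_dir_def Lmat_mult_nth vec_eq_iff zero_prod_def)

text \<open>Links the two complexifications in use: pairs of real states and complex stacked
  vectors.\<close>

lemma spectrum_JmatI:
  fixes m :: "'n::finite \<Rightarrow> real"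
  assumes m: "\<And>i. m i \<noteq> 0" and "z \<noteq> 0" "cmap (vf_deriv y V m d \<delta>) z = cscale l z"
  shows "l \<in> spectrum (Jmat y V m d \<delta>)"
proof -
  define v where "v = (\<chi> p. Complex (stack (fst z) $ p) (stack (snd z) $ p))"
  have ReIm: "(\<chi> p. Re (v $ p)) = stack (fst z)" "(\<chi> p. Im (v $ p)) = stack (snd z)"
    by (simp_all add: v_def vec_eq_iff)
  have "v \<noteq> 0"
  proof
    assume "v = 0"
    then have "(\<chi> p. Re (v $ p)) = stack 0" "(\<chi> p. Im (v $ p)) = stack 0"
      by (simp_all add: stack_def vec_eq_iff split: sum.split)
    then have "fst z = 0" "snd z = 0"
      by (simp_all only: ReIm stack_inject)
    then show False using \<open>z \<noteq> 0\<close> by (simp add: prod_eq_iff)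
  qed
  have *: "vf_deriv y V m d \<delta> (fst z) = Re l *\<^sub>R fst z - Im l *\<^sub>R snd z"
    "vf_deriv y V m d \<delta> (snd z) = Re l *\<^sub>R snd z + Im l *\<^sub>R fst z"
    using assms(3) by (simp_all add: cmap_def cscale_def)
  have st: "stack (a *\<^sub>R x - b *\<^sub>R x') $ p = a * stack x $ p - b * stack x' $ p"
    "stack (a *\<^sub>R x + b *\<^sub>R x') $ p = a * stack x $ p + b * stack x' $ p"
    for a b p and x x' :: "(real^'n) \<times> (real^'n)"
    by (simp_all add: stack_def split: sum.split)
  have "map_matrix complex_of_real (Jmat y V m d \<delta>) *v v = l *s v"
  proof (rule vec_eq_iff[THEN iffD2], rule allI)
    fix p
    show "(map_matrix complex_of_real (Jmat y V m d \<delta>) *v v) $ p = (l *s v) $ p"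
      unfolding complexified_mult_nth ReIm Jmat_mult_stack[OF m] * st
      by (simp add: v_def complex_eq_iff)
  qed
  with \<open>v \<noteq> 0\<close> show ?thesis by (auto simp: spectrum_def eigenspace_def)
qed

section \<open>The microgrid at an equilibrium\<close>

locale microgrid_equilibrium =
  fixes y :: "'n::finite \<Rightarrow> 'n \<Rightarrow> complex" and V Ps m d :: "'n \<Rightarrow> real" and \<delta> \<omega> :: "real^'n"
  assumes y: "line_admittances y" and V_pos: "\<And>i. V i > 0" and EP: "is_EP y V Ps (\<delta>, \<omega>)"
    and Omega: "(\<delta>, \<omega>) \<in> Omega y" and m_pos: "\<And>i. m i > 0" and d_pos: "\<And>i. d i > 0"
    and connected: "connected_grid y"
begin

definition w :: "'n \<Rightarrow> 'n \<Rightarrow> real" where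
  "w i k = V i * V k * Ymod y i k * sin (Yang y i k - \<delta> $ i + \<delta> $ k)"

abbreviation "J \<equiv> Jmat y V m d \<delta>"

lemma m_nz: "m i \<noteq> 0"
  using m_pos[of i] by simp

text \<open>In \<open>Omega\<close> the shifted angle of every line lies strictly between 0 and pi,
  where the sine is positive.\<close>

lemma w_pos: "(i, k) \<in> lines y \<Longrightarrow> 0 < w i k"
  using Omega V_pos
  by (force simp: w_def Omega_def lines_def Ymod_def admittance_matrix_def intro!: mult_pos_pos sin_gt_zero)

lemma w_nonneg: "i \<noteq> k \<Longrightarrow> 0 \<le> w i k"
proof (cases "y i k = 0")
  case True
  then show "i \<noteq> k \<Longrightarrow> 0 \<le> w i k" by (simp add: w_def Ymod_def admittance_matrix_def)
next
  case False
  then show "i \<noteq> k \<Longrightarrow> 0 \<le> w i k" using w_pos[of i k] by (simp add: lines_def)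
qed

lemma laplacian_superharmonic:
  "(\<And>i. 0 \<le> (\<Sum>k\<in>UNIV. w i k * (a i - a k))) \<Longrightarrow> a i = a k"
  using superharmonic_constant[of w "lines y" a i k] w_nonneg w_pos connected
  by (auto simp: connected_grid_def)

lemma eigenspace_J:
  "v \<in> eigenspace J l \<longleftrightarrow> (\<forall>i. v $ Inr i = l * v $ Inl i \<and>
    (of_real (m i) * l + of_real (d i)) * v $ Inr i +
    (\<Sum>k\<in>UNIV. of_real (w i k) * (v $ Inl i - v $ Inl k)) = 0)"
  using eigenspace_Jmat_iff[of m v y V d \<delta> l] m_nz by (simp add: w_def)

text \<open>The upper half of an eigenvector serves as \<open>a\<close>; it cannot vanish, because
  the lower half is \<open>l\<close> times it.\<close>

lemma eigenvector_J:
  assumes "l \<in> spectrum J"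
  obtains a where "a \<noteq> 0"
    "\<And>i. (of_real (m i) * l\<^sup>2 + of_real (d i) * l) * a $ i +
      (\<Sum>k\<in>UNIV. of_real (w i k) * (a $ i - a $ k)) = 0"
proof -
  obtain v where v: "v \<in> eigenspace J l" "v \<noteq> 0"
    using assms by (auto simp: spectrum_def)
  have "(\<chi> i. v $ Inl i) \<noteq> 0"
  proof
    assume *: "(\<chi> i. v $ Inl i) = 0"
    then have "v $ Inl i = 0" for i by (simp add: vec_eq_iff)
    moreover from this have "v $ Inr i = 0" for i using v(1) by (simp add: eigenspace_J)
    ultimately have "v $ p = 0" for p by (cases p) auto
    then show False using v(2) by (simp add: vec_eq_iff)
  qed
  then show thesis
  proof (rule that)
    show "(of_real (m i) * l\<^sup>2 + of_real (d i) * l) * (\<chi> i. v $ Inl i) $ i +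
      (\<Sum>k\<in>UNIV. of_real (w i k) * ((\<chi> i. v $ Inl i) $ i - (\<chi> i. v $ Inl i) $ k)) = 0" for i
    proof -
      have "v $ Inr i = l * v $ Inl i" "(of_real (m i) * l + of_real (d i)) * v $ Inr i +
        (\<Sum>k\<in>UNIV. of_real (w i k) * (v $ Inl i - v $ Inl k)) = 0"
        using v(1)[unfolded eigenspace_J] by blast+
      then show ?thesis
        by (simp add: power2_eq_square distrib_right mult.assoc)
    qed
  qed
qed

text \<open>Reduces the exclusion of an eigenvalue, in (b) and in (c), to a scalar estimate at each
  node.\<close>

lemma spectrum_dominant:
  assumes "l \<in> spectrum J"
    and "\<And>i. (\<Sum>k\<in>UNIV - {i}. w i k) <
      cmod (of_real (m i) * l\<^sup>2 + of_real (d i) * l + of_real (\<Sum>k\<in>UNIV - {i}. w i k))"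
  shows False
proof -
  obtain a where a: "a \<noteq> 0" "\<And>i. (of_real (m i) * l\<^sup>2 + of_real (d i) * l) * a $ i +
      (\<Sum>k\<in>UNIV. of_real (w i k) * (a $ i - a $ k)) = 0"
    using eigenvector_J[OF assms(1)] by blast
  have "a $ i = 0" for i
    by (rule dominant_laplacian_kernel[where w = w and a = "($) a" and \<mu> = "\<lambda>i. of_real (m i) * l\<^sup>2 + of_real (d i) * l"])
      (use w_nonneg assms(2) a(2) in auto)
  then show False using a(1) by (simp add: vec_eq_iff)
qed

section \<open>Zero and real eigenvalues\<close>

lemma W_nonneg: "0 \<le> (\<Sum>k\<in>UNIV - {i}. w i k)"
  by (intro sum_nonneg w_nonneg) auto

text \<open>For \<open>l = 0\<close> the lower half vanishes and the Laplacian annihilates the upper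
  half; the minimum principle makes its real and imaginary parts constant.\<close>

lemma eigenspace_J_0: "eigenspace J 0 = vec.span {\<chi> p. case p of Inl i \<Rightarrow> 1 | Inr i \<Rightarrow> 0}"
proof (intro set_eqI iffI)
  fix v assume v: "v \<in> eigenspace J 0"
  have eq: "v $ Inr i = 0 * v $ Inl i" "(of_real (m i) * 0 + of_real (d i)) * v $ Inr i +
    (\<Sum>k\<in>UNIV. of_real (w i k) * (v $ Inl i - v $ Inl k)) = 0" for i
    using v[unfolded eigenspace_J] by blast+
  then have Inr: "v $ Inr i = 0" for i by simp
  have lap: "(\<Sum>k\<in>UNIV. of_real (w i k) * (v $ Inl i - v $ Inl k)) = 0" for i
    using eq(2)[of i] unfolding Inr by simp
  have "Re (v $ Inl i) = Re (v $ Inl k)" for i k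
    by (rule laplacian_superharmonic[where a = "\<lambda>i. Re (v $ Inl i)"])
      (use arg_cong[OF lap, of Re] in simp)
  moreover have "Im (v $ Inl i) = Im (v $ Inl k)" for i k
    by (rule laplacian_superharmonic[where a = "\<lambda>i. Im (v $ Inl i)"])
      (use arg_cong[OF lap, of Im] in simp)
  ultimately have const: "v $ Inl i = v $ Inl k" for i k by (simp add: complex_eq_iff)
  define c where "c = v $ Inl undefined"
  have "v $ p = (c *s (\<chi> p. case p of Inl i \<Rightarrow> 1 | Inr i \<Rightarrow> 0)) $ p" for p
  proof (cases p)
    case (Inl i)
    then show ?thesis using const[of i undefined] by (simp add: c_def)
  qed (simp add: Inr)
  then have "v = c *s (\<chi> p. case p of Inl i \<Rightarrow> 1 | Inr i \<Rightarrow> 0)"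
    by (rule vec_eq_iff[THEN iffD2, OF allI])
  then show "v \<in> vec.span {\<chi> p. case p of Inl i \<Rightarrow> 1 | Inr i \<Rightarrow> 0}"
    by (metis vec.span_base vec.span_scale singletonI)
qed (auto simp: vec.span_singleton eigenspace_J)

lemma zero_eigenvalue: "0 \<in> spectrum J" "geometric_multiplicity J 0 = 1"
proof -
  let ?u = "(\<chi> p. case p of Inl i \<Rightarrow> 1 | Inr i \<Rightarrow> 0) :: complex ^ ('n + 'n)"
  have u: "?u \<noteq> 0"
  proof
    assume "?u = 0"
    from arg_cong[OF this, of "\<lambda>v. v $ Inl undefined"] show False by simp
  qed
  have "?u \<in> eigenspace J 0"
    unfolding eigenspace_J_0 by (rule vec.span_base) simp
  then show "0 \<in> spectrum J"
    unfolding spectrum_def mem_Collect_eq using u by (rule rev_bexI)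
  have "vec.dim (vec.span {?u}) = card {?u}"
    unfolding vec.dim_span using u by (intro vec.dim_eq_card_independent) simp
  then show "geometric_multiplicity J 0 = 1"
    by (simp add: geometric_multiplicity_def eigenspace_J_0)
qed

text \<open>For positive \<open>\<mu>\<close> the inertia and damping terms are positive reals added
  to the sum of weights, so strict dominance holds.\<close>

lemma real_eigenvalue_neg:
  assumes "complex_of_real \<mu> \<in> spectrum J" "\<mu> \<noteq> 0"
  shows "\<mu> < 0"
proof (rule ccontr)
  assume "\<not> \<mu> < 0"
  with assms have "\<mu> > 0" by simp
  show False
  proof (rule spectrum_dominant[OF assms(1)])
    fix i
    let ?W = "\<Sum>k\<in>UNIV - {i}. w i k"
    have "of_real (m i) * (complex_of_real \<mu>)\<^sup>2 + of_real (d i) * of_real \<mu> + of_real ?W =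
      of_real (m i * \<mu>\<^sup>2 + d i * \<mu> + ?W)"
      by simp
    moreover have "m i * \<mu>\<^sup>2 + d i * \<mu> > 0"
      using m_pos[of i] d_pos[of i] \<open>\<mu> > 0\<close> by (intro add_pos_pos mult_pos_pos) auto
    ultimately show "?W < cmod (of_real (m i) * (complex_of_real \<mu>)\<^sup>2 + of_real (d i) * of_real \<mu> + of_real ?W)"
      using W_nonneg[of i] by (simp only: norm_of_real)
  qed
qed

text \<open>Modulus times sine of the argument is the imaginary part, so the self term
  \<open>w i i\<close> equals \<open>(V i)\<^sup>2\<close> times the diagonal susceptance; taking it
  out of the reactive power leaves the weights to the other nodes.\<close>

lemma reactive_power: "- Qnet y V \<delta> i - (V i)\<^sup>2 * susceptance_matrix y $ i $ i = (\<Sum>k\<in>UNIV - {i}. w i k)"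
proof -
  have "Im z = cmod z * sin (Arg z)" for z
    by (cases "z = 0") (simp_all add: sin_Arg)
  then have "(V i)\<^sup>2 * susceptance_matrix y $ i $ i = w i i"
    by (simp add: susceptance_matrix_def map_matrix_def w_def Ymod_def Yang_def power2_eq_square)
  then show ?thesis
    by (simp add: Qnet_def w_def[symmetric] sum.remove[of UNIV i])
qed

section \<open>Spectrum under strong damping and without transfer conductances\<close>

lemma spectrum_overdamped:
  assumes "\<And>i. - Qnet y V \<delta> i - (V i)\<^sup>2 * susceptance_matrix y $ i $ i \<le> (d i)\<^sup>2 / (2 * m i)"
  shows "spectrum J \<subseteq> {z. Re z < 0} \<union> {0}"
proof (rule subsetI, rule ccontr)
  fix l assume l: "l \<in> spectrum J" "l \<notin> {z. Re z < 0} \<union> {0}"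
  show False
  proof (rule spectrum_dominant[OF l(1)])
    fix i
    show "(\<Sum>k\<in>UNIV - {i}. w i k) <
      cmod (of_real (m i) * l\<^sup>2 + of_real (d i) * l + of_real (\<Sum>k\<in>UNIV - {i}. w i k))"
      using assms[of i] l(2) m_pos[of i] d_pos[of i] W_nonneg[of i]
      unfolding reactive_power by (intro norm_gt_of_overdamped) auto
  qed
qed

text \<open>A purely inductive line has angle \<open>pi / 2\<close>, so the sine becomes the cosine
  of the angle difference, which is even.\<close>

lemma w_symmetric_lossless:
  assumes "\<And>i k. i \<noteq> k \<Longrightarrow> Re (y i k) = 0"
  shows "w i k = w k i"
proof (cases "i = k")
  case False
  have sym: "y k i = y i k" using y unfolding line_admittances_def by metis
  show ?thesis
  proof (cases "y i k = 0")
    case True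
    then show ?thesis using sym False by (simp add: w_def Ymod_def admittance_matrix_def)
  next
    case nz: False
    have "Im (y i k) \<le> 0" using y False by (simp add: line_admittances_def)
    moreover have "Re (y i k) = 0" using assms False by simp
    ultimately have "- y i k = of_real (- Im (y i k)) * \<i>" "- Im (y i k) > 0"
      using nz by (auto simp: complex_eq_iff)
    then have "Arg (- y i k) = pi / 2"
      by (simp only: Arg_times_of_real Arg_ii)
    then have "Yang y i k = pi / 2" "Yang y k i = pi / 2"
      using False sym by (auto simp: Yang_def admittance_matrix_def)
    moreover have "sin (pi / 2 - \<delta> $ i + \<delta> $ k) = sin (pi / 2 - \<delta> $ k + \<delta> $ i)"
      using sin_cos_eq[of "pi / 2 - \<delta> $ i + \<delta> $ k"] cos_sin_eq[of "\<delta> $ i - \<delta> $ k"] cos_minus[of "\<delta> $ i - \<delta> $ k"]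
        cos_sin_eq[of "\<delta> $ k - \<delta> $ i"] by (simp add: algebra_simps)
    ultimately have "sin (Yang y i k - \<delta> $ i + \<delta> $ k) = sin (Yang y k i - \<delta> $ k + \<delta> $ i)"
      by (simp only:)
    then show ?thesis
      using sym False by (simp add: w_def Ymod_def admittance_matrix_def)
  qed
qed simp

lemma spectrum_lossless:
  assumes "\<And>i k. i \<noteq> k \<Longrightarrow> Re (y i k) = 0"
  shows "spectrum J \<subseteq> {z. Re z < 0} \<union> {0}"
proof
  fix l assume l: "l \<in> spectrum J"
  obtain a where a: "a \<noteq> 0" "\<And>i. (of_real (m i) * l\<^sup>2 + of_real (d i) * l) * a $ i +
      (\<Sum>k\<in>UNIV. of_real (w i k) * (a $ i - a $ k)) = 0"
    using eigenvector_J[OF l] by blast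
  \<comment> \<open>\<open>M\<close>, \<open>D\<close> and \<open>c\<close> are the inertia, damping
    and Laplacian forms at \<open>a\<close>; they become the coefficients of the scalar quadratic
    for \<open>l\<close>.\<close>
  define M D where "M = (\<Sum>i\<in>UNIV. m i * (cmod (a $ i))\<^sup>2)" and "D = (\<Sum>i\<in>UNIV. d i * (cmod (a $ i))\<^sup>2)"
  define c where "c = (\<Sum>i\<in>UNIV. \<Sum>k\<in>UNIV. w i k * (cmod (a $ i - a $ k))\<^sup>2) / 2"
  obtain j where "a $ j \<noteq> 0" using a(1) by (auto simp: vec_eq_iff)
  then have "M > 0" "D > 0"
    unfolding M_def D_def
    by (intro sum_pos2[of UNIV j];
        auto intro!: mult_pos_pos mult_nonneg_nonneg simp: m_pos d_pos less_imp_le)+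
  have "w i k * (cmod (a $ i - a $ k))\<^sup>2 \<ge> 0" for i k
    using w_nonneg[of i k] by (cases "i = k") auto
  then have "c \<ge> 0"
    unfolding c_def by (intro divide_nonneg_pos sum_nonneg) auto
  have "2 * c = (\<Sum>i\<in>UNIV. \<Sum>k\<in>UNIV. w i k * (cmod (a $ i - a $ k))\<^sup>2)"
    by (simp add: c_def)
  moreover have "w i k = w k i" for i k
    using w_symmetric_lossless assms by blast
  ultimately have "2 * (\<Sum>i\<in>UNIV. (\<Sum>k\<in>UNIV. of_real (w i k) * (a $ i - a $ k)) * cnj (a $ i)) = of_real (2 * c)"
    using laplacian_form_symmetric[of w "($) a", OF \<open>\<And>i k. w i k = w k i\<close>] by (simp only:)
  then have form: "(\<Sum>i\<in>UNIV. (\<Sum>k\<in>UNIV. of_real (w i k) * (a $ i - a $ k)) * cnj (a $ i)) = of_real c"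
    unfolding of_real_mult of_real_numeral by simp
  have "0 = (\<Sum>i\<in>UNIV. ((of_real (m i) * l\<^sup>2 + of_real (d i) * l) * a $ i +
      (\<Sum>k\<in>UNIV. of_real (w i k) * (a $ i - a $ k))) * cnj (a $ i))"
    by (simp only: a(2)) simp
  also have "\<dots> = (\<Sum>i\<in>UNIV. of_real (m i * (cmod (a $ i))\<^sup>2) * l\<^sup>2 + of_real (d i * (cmod (a $ i))\<^sup>2) * l +
      (\<Sum>k\<in>UNIV. of_real (w i k) * (a $ i - a $ k)) * cnj (a $ i))"
    by (intro sum.cong refl) (simp only: of_real_mult complex_norm_square, simp add: algebra_simps)
  also have "\<dots> = of_real M * l\<^sup>2 + of_real D * l +
      (\<Sum>i\<in>UNIV. (\<Sum>k\<in>UNIV. of_real (w i k) * (a $ i - a $ k)) * cnj (a $ i))"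
    by (simp add: sum.distrib M_def D_def sum_distrib_right)
  also note form
  finally have "of_real M * l\<^sup>2 + of_real D * l + of_real c = 0" by simp
  then show "l \<in> {z. Re z < 0} \<union> {0}"
    using Re_neg_of_quadratic_root \<open>M > 0\<close> \<open>D > 0\<close> \<open>c \<ge> 0\<close> by blast
qed

section \<open>The linearisation on referred states and stability\<close>

text \<open>Excludes a Jordan chain over the zero eigenvalue. The speeds of \<open>h\<close> all
  equal \<open>c\<close>, so the Laplacian of its angles is \<open>- d i * c\<close>, of one sign;
  the angles are then constant, which forces \<open>c = 0\<close>, and the reference makes the
  constant zero.\<close>

lemma no_generalized_kernel:
  assumes "vf_deriv y V m d \<delta> h = c *\<^sub>R shift_dir" "refer r h = h"
  shows "h = 0"
proof -
  have s: "snd h $ i = c" for i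
    using assms(1) by (auto simp: vf_deriv_def shift_dir_def vec_eq_iff)
  have L: "(\<Sum>k\<in>UNIV. w i k * (fst h $ i - fst h $ k)) = - (d i * c)" for i
  proof -
    have "(- (Lmat y V \<delta> *v fst h) $ i - d i * snd h $ i) / m i = 0"
      using assms(1) by (auto simp: vf_deriv_def shift_dir_def vec_eq_iff)
    then show ?thesis using m_nz[of i] by (simp add: s Lmat_mult_nth w_def)
  qed
  \<comment> \<open>The sign of \<open>c\<close> decides whether the angles or their negatives are
    superharmonic.\<close>
  have const: "fst h $ i = fst h $ k" for i k
  proof (cases "c \<le> 0")
    case True
    show ?thesis
      by (rule laplacian_superharmonic[where a = "\<lambda>i. fst h $ i"])
        (simp only: L, simp add: mult_nonneg_nonpos d_pos True less_imp_le)
  next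
    case False
    have "(\<Sum>k\<in>UNIV. w i k * (- fst h $ i - - fst h $ k)) =
      - (\<Sum>k\<in>UNIV. w i k * (fst h $ i - fst h $ k))" for i
      by (simp add: sum_negf[symmetric] algebra_simps)
    then have "(\<Sum>k\<in>UNIV. w i k * (- fst h $ i - - fst h $ k)) = d i * c" for i
      by (simp only: L minus_minus)
    then have "- fst h $ i = - fst h $ k"
      by (intro laplacian_superharmonic[where a = "\<lambda>i. - fst h $ i"]) (use False d_pos in \<open>simp add: less_imp_le\<close>)
    then show ?thesis by simp
  qed
  have "fst h $ r = 0"
    using arg_cong[OF assms(2), of "\<lambda>h. fst h $ r"] by (simp add: refer_def split: prod.splits)
  with const have "fst h $ i = 0" for i by metis
  moreover have "c = 0"
    using L[of r] d_pos[of r] by (simp add: \<open>\<And>i. fst h $ i = 0\<close>)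
  ultimately show ?thesis using s by (simp add: prod_eq_iff vec_eq_iff)
qed

text \<open>
  The summand \<open>- (h - refer r h)\<close> vanishes on \<open>range (refer r)\<close> and adds only the eigenvalue \<open>- 1\<close>
  on the complement, so that the Lyapunov form can be constructed on the whole space.
\<close>

definition referred_deriv :: "'n \<Rightarrow> (real^'n) \<times> (real^'n) \<Rightarrow> (real^'n) \<times> (real^'n)" where
  "referred_deriv r h = refer r (vf_deriv y V m d \<delta> h) - (h - refer r h)"

lemma linear_referred_deriv: "linear (referred_deriv r)"
proof -
  have "linear (\<lambda>h. refer r (vf_deriv y V m d \<delta> h))"
    using linear_compose[OF linear_vf_deriv linear_refer] by (simp add: o_def)
  then show ?thesis
    unfolding referred_deriv_def by (intro linear_compose_sub linear_ident linear_refer)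
qed

text \<open>The projection \<open>P\<close> onto the shift direction satisfies
  \<open>P (referred_deriv r h) = - P h\<close>, so either \<open>l = - 1\<close> or
  \<open>z\<close> is a referred state. In the second case \<open>z\<close> is corrected to an
  eigenvector of \<open>J\<close> if \<open>l\<close> is nonzero, and
  \<open>no_generalized_kernel\<close> applies if \<open>l = 0\<close>.\<close>

lemma referred_eigenvalue_neg:
  assumes spec: "spectrum J \<subseteq> {z. Re z < 0} \<union> {0}"
    and z: "z \<noteq> 0" "cmap (referred_deriv r) z = cscale l z"
  shows "Re l < 0"
proof -
  define P where "P h = h - refer r h" for h
  have lP: "linear P"
    unfolding P_def by (intro linear_compose_sub linear_ident linear_refer)
  have "P (referred_deriv r h) = - P h" for h
    by (simp add: P_def referred_deriv_def linear_diff[OF linear_refer])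
  then have "cmap P (cmap (referred_deriv r) z) = - cmap P z"
    by (simp add: cmap_def)
  then have "cscale l (cmap P z) = - cmap P z"
    by (simp add: z(2) cmap_cscale[OF lP])
  moreover have "cscale (l + 1) x = cscale l x + x" for x :: "((real^'n) \<times> (real^'n)) \<times> (real^'n) \<times> (real^'n)"
    by (simp add: cscale_def prod_eq_iff algebra_simps)
  ultimately have "cscale (l + 1) (cmap P z) = 0" by simp
  then consider "l = - 1" | "cmap P z = 0"
    unfolding cscale_eq_0_iff eq_neg_iff_add_eq_0 by blast
  then show ?thesis
  proof cases
    case 2
    let ?F = "vf_deriv y V m d \<delta>"
    have R: "refer r (fst z) = fst z" "refer r (snd z) = snd z"
      using arg_cong[OF 2, of fst] arg_cong[OF 2, of snd] by (simp_all add: cmap_def P_def)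
    \<comment> \<open>Referring discards the motion of the angle of \<open>r\<close>;
      \<open>c\<close> is its complex rate.\<close>
    define c where "c = Complex (fst (?F (fst z)) $ r) (fst (?F (snd z)) $ r)"
    define e :: "((real^'n) \<times> (real^'n)) \<times> (real^'n) \<times> (real^'n)" where "e = (shift_dir, 0)"
    have F: "?F h = refer r (?F h) + fst (?F h) $ r *\<^sub>R shift_dir" for h
      using diff_refer[of "?F h" r] by (simp add: algebra_simps)
    have A: "cmap (referred_deriv r) z = (refer r (?F (fst z)), refer r (?F (snd z)))"
      by (simp add: cmap_def referred_deriv_def R)
    have Fz: "cmap ?F z = cscale l z + cscale c e"
      using F[of "fst z"] F[of "snd z"] unfolding z(2)[symmetric] A
      by (simp add: cmap_def cscale_def c_def e_def)
    have "fst (cmap ?F e) = 0" "snd (cmap ?F e) = 0"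
      by (simp_all add: e_def cmap_def linear_0[OF linear_vf_deriv])
    then have "cmap ?F e = 0"
      by (simp only: prod_eq_iff fst_zero snd_zero)
    then have Fe: "cmap ?F (cscale b e) = 0" for b
      by (simp only: cmap_cscale[OF linear_vf_deriv] linear_0[OF linear_cscale])
    show ?thesis
    proof (cases "l = 0")
      case True
      have "?F (fst z) = Re c *\<^sub>R shift_dir" "?F (snd z) = Im c *\<^sub>R shift_dir"
        using arg_cong[OF Fz, of fst] arg_cong[OF Fz, of snd]
        by (simp_all add: True cmap_def cscale_def e_def)
      then have "fst z = 0" "snd z = 0"
        using R no_generalized_kernel by blast+
      then show ?thesis using z(1) by (simp add: prod_eq_iff)
    next
      case False
      \<comment> \<open>The linearisation annihilates \<open>e\<close>, so this multiple of it makes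
        up for the discarded term \<open>cscale c e\<close>.\<close>
      define z' where "z' = z + cscale (c / l) e"
      have "cmap ?F z' = cscale l z'"
        unfolding z'_def using False
        by (simp add: linear_add[OF linear_cmap[OF linear_vf_deriv]] linear_add[OF linear_cscale]
            Fz Fe cscale_cscale)
      moreover have "z' \<noteq> 0"
      proof
        assume "z' = 0"
        then have "z = - cscale (c / l) e"
          by (simp add: z'_def eq_neg_iff_add_eq_0)
        then have "fst z = - Re (c / l) *\<^sub>R shift_dir" "snd z = - Im (c / l) *\<^sub>R shift_dir"
          by (simp_all add: e_def cscale_def)
        moreover have "refer r shift_dir = 0"
          by (simp add: refer_def shift_dir_def vec_eq_iff zero_prod_def)
        ultimately have "refer r (fst z) = 0" "refer r (snd z) = 0"
          by (simp_all add: linear_scale[OF linear_refer] linear_neg[OF linear_refer])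
        then have "fst z = 0" "snd z = 0" by (simp_all only: R)
        then show False using z(1) by (simp add: prod_eq_iff)
      qed
      ultimately have "l \<in> spectrum J"
        using m_nz by (intro spectrum_JmatI)
      with spec False show ?thesis by auto
    qed
  qed simp
qed

text \<open>On referred states \<open>referred_deriv\<close> is the derivative of the referred
  field, so its Lyapunov form fits \<open>linearized_stability\<close>.\<close>

lemma EP_stable:
  assumes spec: "spectrum J \<subseteq> {z. Re z < 0} \<union> {0}"
  shows "EP_locally_asymptotically_stable y V Ps m d (\<delta>, \<omega>)"
  unfolding EP_locally_asymptotically_stable_def
proof
  fix r
  let ?F = "vector_field y V Ps m d" and ?p = "refer r (\<delta>, \<omega>)"
  have eig: "Re l < 0" if "z \<noteq> 0" "cmap (referred_deriv r) z = cscale l z" for l z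
    using referred_eigenvalue_neg[OF spec that] .
  obtain Q a where Q: "bounded_bilinear Q" "\<And>u v. Q u v = Q v u" "a > (0::real)"
    "\<And>u. (norm u)\<^sup>2 \<le> Q u u" "\<And>u. Q u (referred_deriv r u) \<le> - a * Q u u"
    by (rule lyapunov_form_exists[OF linear_referred_deriv]; (erule (1) eig | rule that))
  have bR: "bounded_linear (refer r)"
    using linear_refer by (simp add: linear_conv_bounded_linear)
  have L: "vf_deriv y V m d (fst ?p) = vf_deriv y V m d \<delta>"
    using Lmat_refer[of y V r "(\<delta>, \<omega>)"] by (simp add: fun_eq_iff vf_deriv_def)
  have "(?F has_derivative vf_deriv y V m d \<delta>) (at ?p)"
    using vector_field_has_derivative[where m = m and y = y and V = V and Ps = Ps and d = d
        and \<delta> = "fst ?p" and \<omega> = "snd ?p"] m_nz by (simp add: L)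
  from bounded_linear.has_derivative[OF bR this]
  have der: "(refer r \<circ> ?F has_derivative (\<lambda>h. refer r (vf_deriv y V m d \<delta> h))) (at ?p)"
    by (simp add: o_def)
  show "locally_asymptotically_stable (refer r \<circ> ?F) (range (refer r)) ?p"
  proof (rule linearized_stability[OF Q(1) Q(2) Q(4) Q(3) der])
    have "?F (\<delta>, \<omega>) = 0"
      using EP by (simp add: is_EP_def vector_field_def vec_eq_iff zero_prod_def)
    then show "(refer r \<circ> ?F) ?p = 0"
      by (simp add: vector_field_refer linear_0[OF linear_refer])
  next
    fix x assume "x \<in> range (refer r)"
    then have "refer r (x - ?p) = x - ?p"
      by (auto simp: linear_diff[OF linear_refer])
    then have "referred_deriv r (x - ?p) = refer r (vf_deriv y V m d \<delta> (x - ?p))"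
      by (simp add: referred_deriv_def)
    then show "Q (x - ?p) (refer r (vf_deriv y V m d \<delta> (x - ?p))) \<le> - a * Q (x - ?p) (x - ?p)"
      using Q(5)[of "x - ?p"] by simp
  next
    fix x0 assume x0: "x0 \<in> range (refer r)"
    obtain L where "L-lipschitz_on UNIV ?F" using vector_field_lipschitz by blast
    then obtain x where x: "is_solution ?F UNIV x" "x 0 = x0"
      using lipschitz_global_solution by blast
    show "\<exists>x. is_solution (refer r \<circ> ?F) (range (refer r)) x \<and> x 0 = x0"
    \<comment> \<open>The field does not change under \<open>refer r\<close>, so referring a
      solution of the full system solves the referred one.\<close>
    proof (intro exI[of _ "refer r \<circ> x"] conjI)
      show "(refer r \<circ> x) 0 = x0" using x(2) x0 by auto
      show "is_solution (refer r \<circ> ?F) (range (refer r)) (refer r \<circ> x)"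
        unfolding is_solution_def
      proof (intro allI impI conjI)
        fix t :: real assume "t \<ge> 0"
        then have "(x has_vector_derivative ?F (x t)) (at t within {0..})"
          using x(1) by (simp add: is_solution_def)
        from bounded_linear.has_vector_derivative[OF bR this]
        show "(refer r \<circ> x has_vector_derivative (refer r \<circ> ?F) ((refer r \<circ> x) t)) (at t within {0..})"
          by (simp add: o_def vector_field_refer)
      qed simp
    qed
  qed
qed

end

theorem theorem1:
  fixes y :: "'n::finite \<Rightarrow> 'n \<Rightarrow> complex"
    and V Ps m d :: "'n \<Rightarrow> real"
    and \<delta> \<omega> :: "real^'n"
  assumes "line_admittances y"
    and "\<And>i. V i > 0"
    and "is_EP y V Ps (\<delta>, \<omega>)"
    and "(\<delta>, \<omega>) \<in> Omega y"
    and "\<And>i. m i > 0"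
    and "\<And>i. d i > 0"
    and "connected_grid y"
  shows "(0 \<in> spectrum (Jmat y V m d \<delta>) \<and> geometric_multiplicity (Jmat y V m d \<delta>) 0 = 1) \<and>
    (\<forall>\<mu>::real. complex_of_real \<mu> \<in> spectrum (Jmat y V m d \<delta>) \<and> \<mu> \<noteq> 0 \<longrightarrow> \<mu> < 0) \<and>
    ((\<forall>i. - Qnet y V \<delta> i - (V i)\<^sup>2 * susceptance_matrix y $ i $ i \<le> (d i)\<^sup>2 / (2 * m i)) \<longrightarrow>
      spectrum (Jmat y V m d \<delta>) \<subseteq> {z. Re z < 0} \<union> {0} \<and>
      EP_locally_asymptotically_stable y V Ps m d (\<delta>, \<omega>)) \<and>
    ((\<forall>i k. i \<noteq> k \<longrightarrow> Re (y i k) = 0) \<longrightarrow>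
      spectrum (Jmat y V m d \<delta>) \<subseteq> {z. Re z < 0} \<union> {0} \<and>
      EP_locally_asymptotically_stable y V Ps m d (\<delta>, \<omega>))"
proof -
  interpret microgrid_equilibrium y V Ps m d \<delta> \<omega>
    by unfold_locales (fact assms)+
  show ?thesis
    using zero_eigenvalue real_eigenvalue_neg spectrum_overdamped spectrum_lossless EP_stable
    by blast
qed

end
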